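(* Let $a=(a_i)_{i\in\mathbb Z}$ and $b=(b_i)_{i\in\mathbb Z}$ be two sequences of complex numbers, and write $s_{\mu;a}=\sum_\nu c_{\mu\nu}(a,b)\,s_{\nu;b}$ (expansion in the basis $\{s_{\nu;b}\}$ of $\Lambda$). Then $c_{\mu\nu}(a,b)=0$ unless $\nu\subseteq\mu$ and $d(\nu)=d(\mu)$. If $d(\nu)=d(\mu)=d$ and $\mu=(p_1,\dots,p_d\mid q_1,\dots,q_d)$, $\nu=(p'_1,\dots,p'_d\mid q'_1,\dots,q'_d)$ in Frobenius notation, then $$c_{\mu\nu}(a,b)=\det[c_{p_i,p'_j}(a,b)]_{i,j=1}^d\,\det[c_{q_i,q'_j}(\widehat a,\widehat b)]_{i,j=1}^d,$$ where for integers $p\ge p'\ge0$, $c_{pp'}(a,b)=h_{p-p'}(b_1,\dots,b_{p'+1};-a_1,\dots,-a_p)$, and $c_{pp'}(a,b)=0$ if $p'>p$.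
   Context: $\Lambda$ is the algebra of symmetric functions over $\mathbb C$ with complete homogeneous $h_k$, elementary $e_k$, power sums $\mathbf p_k$. For a sequence $a=(a_i)_{i\in\mathbb Z}$ define $h_{k;a}=\sum_{i=1}^k(-1)^{k-i}e_{k-i}(a_1,\dots,a_{k-1})h_i$ for $k\ge1$, $h_{0;a}=1$, $h_{k;a}=0$ for $k<0$; let $(\tau^ra)_i=a_{i+r}$; and set $s_{\mu;a}=\det[h_{\mu_i-i+j;\,\tau^{1-j}a}]_{i,j=1}^N$ for any $N\ge\ell(\mu)$; these form a basis of $\Lambda$. The dual sequence is $\widehat a_i=-a_{1-i}$. Supersymmetric evaluation: $f\in\Lambda$ is evaluated at $(x;y)=(x_1,\dots,x_m;y_1,\dots,y_n)$ via $\mathbf p_k\mapsto\sum_ix_i^k+(-1)^{k-1}\sum_jy_j^k$; in particular $h_k(x;y)=\sum_{r=0}^kh_{k-r}(x_1,\dots,x_m)e_r(y_1,\dots,y_n)$. Frobenius notation: a diagram with $d$ diagonal boxes is $(p_1,\dots,p_d\mid q_1,\dots,q_d)$, $p_i=\mu_i-i$, $q_i=\mu'_i-i$; $d(\mu)$ denotes the number of diagonal boxes. *)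

theory Defs
  imports Complex_Main "Jordan_Normal_Form.Determinant"
begin

text \<open>Elements of Lambda are represented through their evaluations at finite
lists of variables x_1..x_n (all n): an identity in Lambda holds iff it holds
after every such evaluation.\<close>

fun hcomp :: "nat \<Rightarrow> complex list \<Rightarrow> complex" where
  "hcomp k [] = (if k = 0 then 1 else 0)"
| "hcomp k (x # xs) = (\<Sum>j\<le>k. x ^ j * hcomp (k - j) xs)"

fun ecomp :: "nat \<Rightarrow> complex list \<Rightarrow> complex" where
  "ecomp k [] = (if k = 0 then 1 else 0)"
| "ecomp k (x # xs) = ecomp k xs + (if k = 0 then 0 else x * ecomp (k - 1) xs)"

definition seg :: "(int \<Rightarrow> complex) \<Rightarrow> nat \<Rightarrow> complex list" where
  "seg a n = map (\<lambda>i. a (int i)) [1..<n+1]"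

definition hA :: "(int \<Rightarrow> complex) \<Rightarrow> int \<Rightarrow> complex list \<Rightarrow> complex" where
  "hA a k xs = (if k < 0 then 0 else if k = 0 then 1 else
     (\<Sum>i=1..nat k. (-1) ^ (nat k - i) * ecomp (nat k - i) (seg a (nat k - 1)) * hcomp i xs))"

definition shift :: "int \<Rightarrow> (int \<Rightarrow> complex) \<Rightarrow> (int \<Rightarrow> complex)" where
  "shift r a = (\<lambda>i. a (i + r))"

definition dual_seq :: "(int \<Rightarrow> complex) \<Rightarrow> (int \<Rightarrow> complex)" where
  "dual_seq a = (\<lambda>i. - a (1 - i))"

definition is_partition :: "nat list \<Rightarrow> bool" where
  "is_partition mu \<longleftrightarrow> sorted_wrt (\<lambda>x y. y \<le> x) mu \<and> (\<forall>x\<in>set mu. 0 < x)"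

definition subpart :: "nat list \<Rightarrow> nat list \<Rightarrow> bool" where
  "subpart nu mu \<longleftrightarrow> length nu \<le> length mu \<and> (\<forall>i<length nu. nu ! i \<le> mu ! i)"

text \<open>s_{mu;a} with N = length mu (0-based indices i, j; tau^{1-(j+1)} = tau^{-j}).\<close>
definition schur :: "(int \<Rightarrow> complex) \<Rightarrow> nat list \<Rightarrow> complex list \<Rightarrow> complex" where
  "schur a mu xs = det (mat (length mu) (length mu)
     (\<lambda>(i, j). hA (shift (- int j) a) (int (mu ! i) - int i + int j) xs))"

definition dnum :: "nat list \<Rightarrow> nat" where
  "dnum mu = card {i. i < length mu \<and> i < mu ! i}"

definition conj_part :: "nat list \<Rightarrow> nat \<Rightarrow> nat" where
  "conj_part mu j = card {k. k < length mu \<and> j \<le> mu ! k}"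

text \<open>Frobenius coordinates, 0-based index i < d: p_{i+1}, q_{i+1}.\<close>
definition frob_p :: "nat list \<Rightarrow> nat \<Rightarrow> nat" where
  "frob_p mu i = mu ! i - (i + 1)"

definition frob_q :: "nat list \<Rightarrow> nat \<Rightarrow> nat" where
  "frob_q mu i = conj_part mu (i + 1) - (i + 1)"

text \<open>c_{p p'}(a,b) = h_{p-p'}(b_1..b_{p'+1}; -a_1..-a_p) (supersymmetric), 0 if p' > p.\<close>
definition cpp :: "(int \<Rightarrow> complex) \<Rightarrow> (int \<Rightarrow> complex) \<Rightarrow> nat \<Rightarrow> nat \<Rightarrow> complex" where
  "cpp a b p p' = (if p < p' then 0 else
     (\<Sum>r\<le>p - p'. hcomp (p - p' - r) (seg b (p' + 1)) * ecomp r (map uminus (seg a p))))"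

definition frob_coeff :: "(int \<Rightarrow> complex) \<Rightarrow> (int \<Rightarrow> complex) \<Rightarrow> nat list \<Rightarrow> nat list \<Rightarrow> complex" where
  "frob_coeff a b mu nu =
     det (mat (dnum mu) (dnum mu) (\<lambda>(i, j). cpp a b (frob_p mu i) (frob_p nu j))) *
     det (mat (dnum mu) (dnum mu) (\<lambda>(i, j). cpp (dual_seq a) (dual_seq b) (frob_q mu i) (frob_q nu j)))"

definition is_expansion :: "(int \<Rightarrow> complex) \<Rightarrow> (int \<Rightarrow> complex) \<Rightarrow> nat list \<Rightarrow> (nat list \<Rightarrow> complex) \<Rightarrow> bool" where
  "is_expansion a b mu c \<longleftrightarrow> finite {nu. is_partition nu \<and> c nu \<noteq> 0} \<and>
     (\<forall>xs. schur a mu xs = (\<Sum>nu\<in>{nu. is_partition nu \<and> c nu \<noteq> 0}. c nu * schur b nu xs))"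

end

theory Submission
  imports Defs "HOL-Computational_Algebra.Formal_Power_Series"
begin

text \<open>Let \<open>L\<close> be the functional \<open>z ^ m \<mapsto> h\<^sub>m\<^sub>+\<^sub>1\<close> and \<open>A\<close> the operator sending a polynomial to the
  polynomial part of its product with \<open>\<Sum>m. h\<^sub>m z\<^sup>-\<^sup>m\<close>. In the Jacobi--Trudi matrix of \<open>s\<^sub>\<mu>\<^sub>;\<^sub>a\<close> the row of index
  \<open>p \<ge> 0\<close> has entries \<open>L (f\<^sub>p g\<^sub>j)\<close>, and the rows of negative index form the matrix of \<open>A\<close> in the basis
  \<open>g\<^sub>j\<close>, where \<open>f\<^sub>p = (z - a\<^sub>1) \<dots> (z - a\<^sub>p)\<close> and \<open>g\<^sub>j = (z - a\<^sub>0) \<dots> (z - a\<^sub>1\<^sub>-\<^sub>j)\<close>. Replacing \<open>a\<close> by \<open>b\<close>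
  therefore multiplies the former by the transition matrices of both Newton bases and conjugates the
  latter. The entries of the transition matrices are the \<open>c\<^sub>p\<^sub>p\<^sub>'\<close> of \<open>a, b\<close> and, up to sign, of the
  dual sequences. Clearing the negative rows gives the Giambelli formula and the expansion of hooks;
  the Cauchy--Binet formula then gives the expansion of \<open>s\<^sub>\<mu>\<^sub>;\<^sub>a\<close>. The expansion from \<open>b\<close> to the zero
  sequence is unitriangular, so linear independence reduces to ordinary Schur functions, which are
  quotients of alternants.\<close>

section \<open>Newton bases\<close>

text \<open>Nodes are indexed from 0 over \<open>nat\<close>, so that one definition covers both
  families in play: f_p with nodes a_1, a_2, ... and g_j with nodes a_0, a_(-1), ....\<close>

definition newton :: "(nat \<Rightarrow> complex) \<Rightarrow> nat \<Rightarrow> complex poly" where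
  "newton \<alpha> n = (\<Prod>i<n. [:- \<alpha> i, 1:])"

text \<open>For p' \<le> p, the coefficient of t^(p - p') in the product of the 1 - \<alpha>_i t (i
  < p) divided by the product of the 1 - \<beta>_i t (i \<le> p'). Equivalently, the divided
  difference of \<open>newton \<alpha> p\<close> at \<beta>_0, ..., \<beta>_p'.\<close>

definition newton_coeff :: "(nat \<Rightarrow> complex) \<Rightarrow> (nat \<Rightarrow> complex) \<Rightarrow> nat \<Rightarrow> nat \<Rightarrow> complex" where
  "newton_coeff \<alpha> \<beta> p p' = (if p < p' then 0 else
     (\<Sum>r\<le>p - p'. hcomp (p - p' - r) (map \<beta> [0..<Suc p']) * ecomp r (map (\<lambda>i. - \<alpha> i) [0..<p])))"

section \<open>Generating functions of complete and elementary symmetric polynomials\<close>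

definition hcomp_fps :: "complex list \<Rightarrow> complex fps" where
  "hcomp_fps xs = Abs_fps (\<lambda>k. hcomp k xs)"

definition ecomp_fps :: "complex list \<Rightarrow> complex fps" where
  "ecomp_fps xs = Abs_fps (\<lambda>k. ecomp k xs)"

lemma ecomp_fps_Cons: "ecomp_fps (x # xs) = (1 + fps_const x * fps_X) * ecomp_fps xs"
proof (rule fps_ext)
  fix n
  show "fps_nth (ecomp_fps (x # xs)) n = fps_nth ((1 + fps_const x * fps_X) * ecomp_fps xs) n"
    by (cases n) (simp_all add: ecomp_fps_def algebra_simps)
qed

lemma ecomp_fps_Nil: "ecomp_fps [] = 1"
  by (rule fps_ext) (simp add: ecomp_fps_def)

lemma ecomp_fps_append: "ecomp_fps (xs @ ys) = ecomp_fps xs * ecomp_fps ys"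
  by (induction xs) (simp_all add: ecomp_fps_Cons ecomp_fps_Nil mult.assoc)

lemma ecomp_fps_snoc: "ecomp_fps (xs @ [x]) = ecomp_fps xs * (1 + fps_const x * fps_X)"
  by (simp only: ecomp_fps_append ecomp_fps_Cons ecomp_fps_Nil mult_1_right)

lemma hcomp_fps_Cons: "(1 - fps_const x * fps_X) * hcomp_fps (x # xs) = hcomp_fps xs"
proof (rule fps_ext)
  fix n
  show "fps_nth ((1 - fps_const x * fps_X) * hcomp_fps (x # xs)) n = fps_nth (hcomp_fps xs) n"
  proof (cases n)
    case 0
    then show ?thesis by (simp add: hcomp_fps_def)
  next
    case (Suc m)
    have "(\<Sum>j\<le>Suc m. x ^ j * hcomp (Suc m - j) xs)
        = hcomp (Suc m) xs + x * (\<Sum>j\<le>m. x ^ j * hcomp (m - j) xs)"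
      by (subst sum.atMost_Suc_shift) (simp add: sum_distrib_left mult.assoc)
    then show ?thesis
      unfolding Suc by (simp add: hcomp_fps_def algebra_simps)
  qed
qed

lemma hcomp_fps_Nil: "hcomp_fps [] = 1"
  by (rule fps_ext) (simp add: hcomp_fps_def)

lemma hcomp_fps_mult: "ecomp_fps (map uminus xs) * hcomp_fps xs = 1"
proof (induction xs)
  case Nil
  then show ?case by (simp add: hcomp_fps_Nil ecomp_fps_Nil)
next
  case (Cons x xs)
  have "1 + fps_const (- x) * fps_X = 1 - fps_const x * (fps_X :: complex fps)"
    by (rule fps_ext) simp
  then have "ecomp_fps (map uminus (x # xs)) * hcomp_fps (x # xs)
    = ecomp_fps (map uminus xs) * ((1 - fps_const x * fps_X) * hcomp_fps (x # xs))"
    by (simp only: list.map ecomp_fps_Cons) (simp add: algebra_simps)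
  then show ?case by (simp only: hcomp_fps_Cons Cons)
qed

text \<open>\<open>hcomp\<close> recurses on the head of the list, whereas Newton nodes are added at
  the end. The series of \<open>ecomp\<close> is multiplicative under appending and, up to signs,
  inverse to that of \<open>hcomp\<close>, which transfers the rule to the last variable.\<close>

lemma hcomp_fps_snoc: "hcomp_fps (xs @ [x]) * (1 - fps_const x * fps_X) = hcomp_fps xs"
proof -
  have c: "1 + fps_const (- x) * fps_X = 1 - fps_const x * (fps_X :: complex fps)"
    by (rule fps_ext) simp
  have "ecomp_fps (map uminus xs) * (hcomp_fps (xs @ [x]) * (1 - fps_const x * fps_X)) = 1"
    using hcomp_fps_mult[of "xs @ [x]"]
    by (simp only: map_append list.map ecomp_fps_snoc c) (simp only: mult_ac)
  moreover have "ecomp_fps (map uminus xs) \<noteq> 0"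
    using hcomp_fps_mult[of xs] by auto
  ultimately show ?thesis
    using hcomp_fps_mult[of xs] by (metis mult_cancel_left)
qed

section \<open>Transition coefficients between Newton bases\<close>

lemma newton_coeff_fps:
  assumes "p' \<le> p"
  shows "newton_coeff \<alpha> \<beta> p p' =
    fps_nth (hcomp_fps (map \<beta> [0..<Suc p']) * ecomp_fps (map (\<lambda>i. - \<alpha> i) [0..<p])) (p - p')"
proof -
  have "fps_nth (hcomp_fps (map \<beta> [0..<Suc p']) * ecomp_fps (map (\<lambda>i. - \<alpha> i) [0..<p])) (p - p')
     = fps_nth (ecomp_fps (map (\<lambda>i. - \<alpha> i) [0..<p]) * hcomp_fps (map \<beta> [0..<Suc p'])) (p - p')"
    by (simp only: mult.commute)
  also have "\<dots> = newton_coeff \<alpha> \<beta> p p'"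
    unfolding fps_mult_nth newton_coeff_def ecomp_fps_def hcomp_fps_def
    using assms by (simp add: atLeast0AtMost mult.commute)
  finally show ?thesis ..
qed

lemma ecomp_eq_0: "length xs < k \<Longrightarrow> ecomp k xs = 0"
  by (induction xs arbitrary: k) auto

lemma newton_coeff_self [simp]: "newton_coeff \<alpha> \<beta> p p = 1"
proof -
  have "hcomp 0 xs = 1" "ecomp 0 xs = 1" for xs by (induction xs) auto
  then show ?thesis by (simp add: newton_coeff_def)
qed

lemma newton_coeff_eq_0 [simp]: "p < p' \<Longrightarrow> newton_coeff \<alpha> \<beta> p p' = 0"
  by (simp add: newton_coeff_def)

text \<open>Raising p multiplies the generating series by 1 - \<alpha>_p t = (1 - \<beta>_p' t) +
  (\<beta>_p' - \<alpha>_p) t. The first summand cancels the last denominator and gives the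
  coefficient for p' - 1; the second lowers the degree by one.\<close>

lemma newton_coeff_Suc:
  "newton_coeff \<alpha> \<beta> (Suc p) p' = (if p' = 0 then 0 else newton_coeff \<alpha> \<beta> p (p' - 1))
     + (\<beta> p' - \<alpha> p) * newton_coeff \<alpha> \<beta> p p'"
proof (cases "p' \<le> p")
  case True
  define F where "F = hcomp_fps (map \<beta> [0..<Suc p']) * ecomp_fps (map (\<lambda>i. - \<alpha> i) [0..<p])"
  define n where "n = p - p'"
  have n: "Suc p - p' = Suc n" using True by (simp add: n_def)
  have nth: "fps_nth (F * (1 - fps_const c * fps_X)) (Suc n) = fps_nth F (Suc n) - c * fps_nth F n" for c
  proof -
    have "F * (1 - fps_const c * fps_X) = F - fps_const c * (fps_X * F)" by (simp add: algebra_simps)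
    then show ?thesis by simp
  qed
  have "ecomp_fps (map (\<lambda>i. - \<alpha> i) [0..<Suc p])
      = ecomp_fps (map (\<lambda>i. - \<alpha> i) [0..<p]) * (1 + fps_const (- \<alpha> p) * fps_X)"
    by (simp only: upt_Suc_append[OF le0] map_append list.map ecomp_fps_snoc)
  moreover have "1 + fps_const (- \<alpha> p) * fps_X = 1 - fps_const (\<alpha> p) * (fps_X :: complex fps)"
    by (rule fps_ext) simp
  ultimately have "newton_coeff \<alpha> \<beta> (Suc p) p' = fps_nth (F * (1 - fps_const (\<alpha> p) * fps_X)) (Suc n)"
    using True newton_coeff_fps[of p' "Suc p" \<alpha> \<beta>] by (simp only: n F_def le_Suc_eq) (simp add: mult_ac)
  then have lhs: "newton_coeff \<alpha> \<beta> (Suc p) p' = fps_nth F (Suc n) - \<alpha> p * fps_nth F n"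
    by (simp only: nth)
  have Fn: "newton_coeff \<alpha> \<beta> p p' = fps_nth F n"
    using newton_coeff_fps[OF True] by (simp add: F_def n_def)
  have B: "F * (1 - fps_const (\<beta> p') * fps_X)
      = hcomp_fps (map \<beta> [0..<p']) * ecomp_fps (map (\<lambda>i. - \<alpha> i) [0..<p])"
  proof -
    have "map \<beta> [0..<Suc p'] = map \<beta> [0..<p'] @ [\<beta> p']" by simp
    then have "hcomp_fps (map \<beta> [0..<Suc p']) * (1 - fps_const (\<beta> p') * fps_X) = hcomp_fps (map \<beta> [0..<p'])"
      by (simp only: hcomp_fps_snoc)
    from this[symmetric] show ?thesis unfolding F_def by (simp only: mult_ac)
  qed
  have rhs: "(if p' = 0 then 0 else newton_coeff \<alpha> \<beta> p (p' - 1))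
      = fps_nth (F * (1 - fps_const (\<beta> p') * fps_X)) (Suc n)"
  proof (cases p')
    case 0
    \<comment> \<open>For p' = 0 no denominator is left: the series is a polynomial in t of degree
      at most p, and the coefficient asked for is that of t^(p + 1).\<close>
    then have "fps_nth (F * (1 - fps_const (\<beta> p') * fps_X)) (Suc n)
        = ecomp (Suc n) (map (\<lambda>i. - \<alpha> i) [0..<p])"
      unfolding B by (simp add: hcomp_fps_Nil ecomp_fps_def)
    also have "\<dots> = 0" by (rule ecomp_eq_0) (simp add: n_def 0)
    finally show ?thesis using 0 by simp
  next
    case (Suc m)
    then have "p - m = Suc n" "m \<le> p" using True by (auto simp: n_def)
    then show ?thesis unfolding B using newton_coeff_fps[of m p \<alpha> \<beta>] Suc by simp
  qed
  show ?thesis unfolding lhs rhs Fn nth by (simp add: algebra_simps)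
next
  case False
  then show ?thesis
    by (cases "p' = Suc p") auto
qed

lemma newton_Suc: "newton \<alpha> (Suc n) = newton \<alpha> n * [:- \<alpha> n, 1:]"
  by (simp add: newton_def)

lemma newton_Suc_shift: "newton \<alpha> (Suc n) = [:- \<alpha> 0, 1:] * newton (\<lambda>i. \<alpha> (Suc i)) n"
  unfolding newton_def by (rule prod.lessThan_Suc_shift)

lemma newton_0 [simp]: "newton \<alpha> 0 = 1"
  by (simp add: newton_def)

lemma newton_rev: "newton \<alpha> n = newton (\<lambda>i. \<alpha> (n - Suc i)) n"
  unfolding newton_def by (rule prod.nat_diff_reindex[symmetric])

lemma newton_add: "newton \<alpha> (m + n) = newton \<alpha> m * newton (\<lambda>i. \<alpha> (m + i)) n"
  by (induction n) (simp_all add: newton_Suc mult_ac)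

lemma newton_cong: "(\<And>i. i < n \<Longrightarrow> \<alpha> i = \<beta> i) \<Longrightarrow> newton \<alpha> n = newton \<beta> n"
  unfolding newton_def by (rule prod.cong) auto

lemma degree_newton [simp]: "degree (newton \<alpha> n) = n"
  unfolding newton_def by (subst degree_prod_eq_sum_degree) auto

lemma coeff_newton_self [simp]: "coeff (newton \<alpha> n) n = 1"
proof -
  have "lead_coeff (newton \<alpha> n) = 1"
    unfolding newton_def by (simp only: lead_coeff_prod) simp
  then show ?thesis by simp
qed

text \<open>On the k-th basis element the new factor z - \<alpha>_p splits as (z - \<beta>_k) +
  (\<beta>_k - \<alpha>_p), a step up in the basis plus a scalar. Collecting terms gives the
  recurrence \<open>newton_coeff_Suc\<close>.\<close>

lemma newton_expansion:
  "newton \<alpha> p = (\<Sum>p'\<le>p. smult (newton_coeff \<alpha> \<beta> p p') (newton \<beta> p'))"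
proof (induction p)
  case 0
  then show ?case by simp
next
  case (Suc p)
  let ?c = "newton_coeff \<alpha> \<beta>"
  have lin: "newton \<beta> k * [:- \<alpha> p, 1:] = newton \<beta> (Suc k) + smult (\<beta> k - \<alpha> p) (newton \<beta> k)" for k
  proof -
    have "[:- \<alpha> p, 1:] = [:- \<beta> k, 1:] + [:\<beta> k - \<alpha> p:]" by simp
    then have "newton \<beta> k * [:- \<alpha> p, 1:] = newton \<beta> k * [:- \<beta> k, 1:] + newton \<beta> k * [:\<beta> k - \<alpha> p:]"
      by (metis distrib_left)
    then show ?thesis by (simp add: newton_Suc)
  qed
  have "newton \<alpha> (Suc p) = (\<Sum>k\<le>p. smult (?c p k) (newton \<beta> k)) * [:- \<alpha> p, 1:]"
    unfolding newton_Suc Suc.IH[symmetric] ..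
  also have "\<dots> = (\<Sum>k\<le>p. smult (?c p k) (newton \<beta> k * [:- \<alpha> p, 1:]))"
    by (simp only: sum_distrib_right mult_smult_left)
  also have "\<dots> = (\<Sum>k\<le>p. smult (?c p k) (newton \<beta> (Suc k)))
      + (\<Sum>k\<le>p. smult ((\<beta> k - \<alpha> p) * ?c p k) (newton \<beta> k))"
    by (simp only: lin smult_add_right sum.distrib smult_smult mult.commute)
  also have "(\<Sum>k\<le>p. smult (?c p k) (newton \<beta> (Suc k)))
      = (\<Sum>k\<le>Suc p. smult (if k = 0 then 0 else ?c p (k - 1)) (newton \<beta> k))"
    by (subst sum.atMost_Suc_shift) simp
  also have "(\<Sum>k\<le>p. smult ((\<beta> k - \<alpha> p) * ?c p k) (newton \<beta> k))
      = (\<Sum>k\<le>Suc p. smult ((\<beta> k - \<alpha> p) * ?c p k) (newton \<beta> k))"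
    by simp
  finally show ?case
    by (simp only: sum.distrib[symmetric] smult_add_left[symmetric] newton_coeff_Suc)
qed

lemma newton_expansion_lessThan:
  assumes "p < K"
  shows "newton \<alpha> p = (\<Sum>p'<K. smult (newton_coeff \<alpha> \<beta> p p') (newton \<beta> p'))"
  unfolding newton_expansion[of \<alpha> p \<beta>]
  by (rule sum.mono_neutral_left) (use assms in auto)

text \<open>Homogeneity of degree p - p'. The sign is written with p + p' to avoid truncated
  subtraction; it has the same parity.\<close>

lemma newton_coeff_uminus:
  "newton_coeff (\<lambda>i. - \<alpha> i) (\<lambda>i. - \<beta> i) p p' = (-1) ^ (p + p') * newton_coeff \<alpha> \<beta> p p'"
proof (induction p arbitrary: p')
  case 0
  then show ?case by (cases p') auto
next
  case (Suc p)
  show ?case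
    by (cases p') (simp_all add: newton_coeff_Suc Suc algebra_simps)
qed

text \<open>The basis polynomials are monic of increasing degree, so the top coefficient settles the
  last index and induction removes it.\<close>

lemma newton_lin_indep:
  assumes "(\<Sum>q<N. smult (x q) (newton \<beta> q)) = (\<Sum>q<N. smult (y q) (newton \<beta> q))" "q < N"
  shows "x q = y q"
  using assms
proof (induction N arbitrary: q)
  case 0
  then show ?case by simp
next
  case (Suc N)
  have c0: "coeff (\<Sum>q<N. smult (z q) (newton \<beta> q)) N = 0" for z
    by (simp add: coeff_sum coeff_eq_0)
  have "coeff (\<Sum>q<Suc N. smult (x q) (newton \<beta> q)) N = coeff (\<Sum>q<Suc N. smult (y q) (newton \<beta> q)) N"
    using Suc.prems by simp
  then have N: "x N = y N" using c0[of x] c0[of y] by simp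
  with Suc.prems have "(\<Sum>q<N. smult (x q) (newton \<beta> q)) = (\<Sum>q<N. smult (y q) (newton \<beta> q))"
    by simp
  with Suc N show ?case by (cases "q = N") auto
qed

lemma coeff_newton:
  "i \<le> n \<Longrightarrow> coeff (newton \<alpha> n) i = (-1) ^ (n - i) * ecomp (n - i) (map \<alpha> [0..<n])"
proof (induction n arbitrary: \<alpha> i)
  case 0
  then show ?case by simp
next
  case (Suc n)
  have m: "map \<alpha> [0..<Suc n] = \<alpha> 0 # map (\<lambda>i. \<alpha> (Suc i)) [0..<n]"
    by (simp only: upt_conv_Cons[OF zero_less_Suc] map_Suc_upt[symmetric] list.map map_map o_def)
  show ?case
  proof (cases i)
    case 0
    have "ecomp (Suc n) (map (\<lambda>i. \<alpha> (Suc i)) [0..<n]) = 0" by (rule ecomp_eq_0) simp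
    with 0 show ?thesis
      unfolding m newton_Suc_shift by (simp add: Suc.IH)
  next
    case (Suc k)
    show ?thesis
    proof (cases "k = n")
      case True
      have "coeff (newton (\<lambda>i. \<alpha> (Suc i)) n) (Suc n) = 0"
        by (rule coeff_eq_0) simp
      moreover have "ecomp 0 xs = 1" for xs by (induction xs) auto
      ultimately show ?thesis unfolding m newton_Suc_shift using Suc True by simp
    next
      case False
      with Suc Suc.prems have "Suc k \<le> n" by simp
      then have "n - k = Suc (n - Suc k)" by simp
      with \<open>Suc k \<le> n\<close> show ?thesis
        unfolding m newton_Suc_shift Suc
        by (simp add: Suc.IH algebra_simps)
    qed
  qed
qed

text \<open>With \<open>h m = h\<^sub>m\<close>, the functional sends \<open>z ^ m\<close> to \<open>h\<^sub>m\<^sub>+\<^sub>1\<close> and the operator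
  is multiplication by the series \<open>\<Sum>m. h\<^sub>m z\<^sup>-\<^sup>m\<close> followed by discarding the negative powers of \<open>z\<close>.\<close>

definition poly_functional :: "(nat \<Rightarrow> complex) \<Rightarrow> complex poly \<Rightarrow> complex" where
  "poly_functional h p = (\<Sum>i\<le>degree p. coeff p i * h (Suc i))"

definition poly_operator :: "(nat \<Rightarrow> complex) \<Rightarrow> complex poly \<Rightarrow> complex poly" where
  "poly_operator h p = (\<Sum>i\<le>degree p. smult (coeff p i) (\<Sum>m\<le>i. monom (h m) (i - m)))"

lemma poly_functional_bound:
  assumes "degree p \<le> n" shows "poly_functional h p = (\<Sum>i\<le>n. coeff p i * h (Suc i))"
  unfolding poly_functional_def
  by (rule sum.mono_neutral_left) (use assms in \<open>auto simp: coeff_eq_0\<close>)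

lemma poly_operator_bound:
  assumes "degree p \<le> n"
  shows "poly_operator h p = (\<Sum>i\<le>n. smult (coeff p i) (\<Sum>m\<le>i. monom (h m) (i - m)))"
  unfolding poly_operator_def
  by (rule sum.mono_neutral_left) (use assms in \<open>auto simp: coeff_eq_0\<close>)

lemma poly_functional_add: "poly_functional h (p + q) = poly_functional h p + poly_functional h q"
proof -
  define n where "n = max (degree p) (degree q)"
  have "degree (p + q) \<le> n" "degree p \<le> n" "degree q \<le> n"
    by (auto simp: n_def degree_add_le_max)
  then show ?thesis
    by (simp add: poly_functional_bound[of _ n] sum.distrib algebra_simps)
qed

lemma poly_functional_smult: "poly_functional h (smult c p) = c * poly_functional h p"
  by (simp add: poly_functional_bound[of _ "degree p"] degree_smult_le sum_distrib_left mult.assoc)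

lemma poly_functional_0 [simp]: "poly_functional h 0 = 0"
  by (simp add: poly_functional_def)

lemma poly_functional_sum: "poly_functional h (\<Sum>i\<in>I. f i) = (\<Sum>i\<in>I. poly_functional h (f i))"
  by (induction I rule: infinite_finite_induct) (simp_all add: poly_functional_add)

lemma poly_operator_add: "poly_operator h (p + q) = poly_operator h p + poly_operator h q"
proof -
  define n where "n = max (degree p) (degree q)"
  have "degree (p + q) \<le> n" "degree p \<le> n" "degree q \<le> n"
    by (auto simp: n_def degree_add_le_max)
  then show ?thesis
    by (simp add: poly_operator_bound[of _ n] sum.distrib smult_add_left)
qed

lemma poly_operator_smult: "poly_operator h (smult c p) = smult c (poly_operator h p)"
  by (simp add: poly_operator_bound[of _ "degree p"] degree_smult_le poly_eq_iff coeff_sum sum_distrib_left mult.assoc)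

lemma poly_operator_0 [simp]: "poly_operator h 0 = 0"
  by (simp add: poly_operator_def)

lemma poly_operator_sum: "poly_operator h (\<Sum>i\<in>I. f i) = (\<Sum>i\<in>I. poly_operator h (f i))"
  by (induction I rule: infinite_finite_induct) (simp_all add: poly_operator_add)

text \<open>Multiplication by z lifts the discarded coefficient of z^(-1), which is L(p), to the
  constant term.\<close>

lemma poly_operator_pCons_0:
  "poly_operator h (pCons 0 p) = pCons (poly_functional h p) (poly_operator h p)"
proof -
  have step: "(\<Sum>m\<le>Suc i. monom (h m) (Suc i - m)) = [:h (Suc i):] + pCons 0 (\<Sum>m\<le>i. monom (h m) (i - m))" for i
  proof -
    have "(\<Sum>m\<le>Suc i. monom (h m) (Suc i - m)) = [:h (Suc i):] + (\<Sum>m\<le>i. monom (h m) (Suc i - m))"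
      by (simp add: monom_0)
    also have "(\<Sum>m\<le>i. monom (h m) (Suc i - m)) = (\<Sum>m\<le>i. pCons 0 (monom (h m) (i - m)))"
      by (rule sum.cong) (simp_all add: Suc_diff_le monom_Suc)
    also have "\<dots> = pCons 0 (\<Sum>m\<le>i. monom (h m) (i - m))"
      by (simp add: poly_eq_iff coeff_sum coeff_pCons split: nat.split)
    finally show ?thesis .
  qed
  have "poly_operator h (pCons 0 p)
      = (\<Sum>i\<le>Suc (degree p). smult (coeff (pCons 0 p) i) (\<Sum>m\<le>i. monom (h m) (i - m)))"
    by (rule poly_operator_bound) (rule degree_pCons_le)
  also have "\<dots> = (\<Sum>i\<le>degree p. smult (coeff p i) ([:h (Suc i):] + pCons 0 (\<Sum>m\<le>i. monom (h m) (i - m))))"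
    by (subst sum.atMost_Suc_shift) (simp add: step del: sum.atMost_Suc)
  also have "\<dots> = [:\<Sum>i\<le>degree p. coeff p i * h (Suc i):]
      + pCons 0 (\<Sum>i\<le>degree p. smult (coeff p i) (\<Sum>m\<le>i. monom (h m) (i - m)))"
    by (simp add: poly_eq_iff coeff_sum coeff_pCons split: nat.split)
  finally show ?thesis
    by (simp add: poly_functional_def poly_operator_def)
qed

lemma poly_operator_linear_mult:
  "poly_operator h ([:- c, 1:] * p) = [:- c, 1:] * poly_operator h p + [:poly_functional h p:]"
proof -
  have "[:- c, 1:] * p = pCons 0 p + smult (- c) p" by (simp add: algebra_simps)
  then show ?thesis
    by (simp only: poly_operator_add poly_operator_smult poly_operator_pCons_0) simp
qed

text \<open>The factors are peeled off from the front by \<open>poly_operator_linear_mult\<close>: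
  removing z - \<alpha>_q leaves behind L of the product of all later factors. The condition on
  \<open>h 0\<close> makes the operator fix the constant 1.\<close>

lemma poly_operator_newton:
  assumes "h 0 = 1"
  shows "poly_operator h (newton \<alpha> j) = newton \<alpha> j +
    (\<Sum>q<j. smult (poly_functional h (newton (\<lambda>i. \<alpha> (Suc q + i)) (j - Suc q))) (newton \<alpha> q))"
proof (induction j arbitrary: \<alpha>)
  case 0
  then show ?case using assms by (simp add: poly_operator_def monom_0)
next
  case (Suc j)
  let ?a = "\<lambda>i. \<alpha> (Suc i)"
  have "poly_operator h (newton \<alpha> (Suc j)) = [:- \<alpha> 0, 1:] * newton ?a j +
     (\<Sum>q<j. smult (poly_functional h (newton (\<lambda>i. ?a (Suc q + i)) (j - Suc q))) ([:- \<alpha> 0, 1:] * newton ?a q))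
     + [:poly_functional h (newton ?a j):]"
    unfolding newton_Suc_shift[of \<alpha> j] poly_operator_linear_mult Suc.IH
    by (simp only: distrib_left sum_distrib_left mult_smult_right)
  also have "\<dots> = newton \<alpha> (Suc j) + 
    (\<Sum>q<Suc j. smult (poly_functional h (newton (\<lambda>i. \<alpha> (Suc q + i)) (Suc j - Suc q))) (newton \<alpha> q))"
    unfolding newton_Suc_shift[of \<alpha>, symmetric]
    by (subst sum.lessThan_Suc_shift) (simp add: newton_Suc_shift[symmetric])
  finally show ?case .
qed

section \<open>The multiparameter functions and coefficients in terms of Newton polynomials\<close>

lemma seg_conv_map: "seg a n = map (\<lambda>i. a (int i + 1)) [0..<n]"
  unfolding seg_def by (rule nth_equalityI) (auto simp: add.commute simp del: upt_Suc)

text \<open>By Vieta, the signed elementary symmetric functions in h_{k+1;a} are the coefficients of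
  (z - a_1) ... (z - a_k), and L replaces z^i by h_(i+1).\<close>

lemma hA_poly_functional:
  "hA a (int (Suc k)) xs = poly_functional (\<lambda>m. hcomp m xs) (newton (\<lambda>i. a (int i + 1)) k)"
proof -
  have "poly_functional (\<lambda>m. hcomp m xs) (newton (\<lambda>i. a (int i + 1)) k) =
     (\<Sum>i\<le>k. (-1) ^ (k - i) * ecomp (k - i) (seg a k) * hcomp (Suc i) xs)"
    unfolding poly_functional_def degree_newton seg_conv_map
    by (rule sum.cong) (simp_all add: coeff_newton)
  also have "\<dots> = (\<Sum>i=Suc 0..Suc k. (-1) ^ (Suc k - i) * ecomp (Suc k - i) (seg a k) * hcomp i xs)"
    by (subst sum.shift_bounds_cl_Suc_ivl) (simp add: atLeast0AtMost)
  finally show ?thesis by (simp add: hA_def nat_add_distrib)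
qed


lemma cpp_eq_newton_coeff:
  "cpp a b p p' = newton_coeff (\<lambda>i. a (int i + 1)) (\<lambda>i. b (int i + 1)) p p'"
  by (simp add: cpp_def newton_coeff_def seg_conv_map o_def del: upt_Suc)

text \<open>The dual sequence has entry -a_(-i) at i + 1: it lists the nodes of g_j with opposite
  sign, and homogeneity extracts that sign.\<close>

lemma cpp_dual_eq_newton_coeff:
  "cpp (dual_seq a) (dual_seq b) q q' =
     (-1) ^ (q + q') * newton_coeff (\<lambda>i. a (- int i)) (\<lambda>i. b (- int i)) q q'"
  unfolding cpp_eq_newton_coeff newton_coeff_uminus[symmetric]
  by (simp add: dual_seq_def)

section \<open>Rows of the Jacobi--Trudi matrix\<close>

text \<open>The Jacobi--Trudi matrix of \<open>\<mu>\<close> consists of the rows \<open>k = \<mu>\<^sub>i - i - 1\<close> (indices from 0):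
  the nonnegative ones are the Frobenius coordinates \<open>p\<^sub>i\<close>, and the negative ones are all \<open>- r - 1\<close>
  with \<open>r\<close> not among the \<open>q\<^sub>i\<close>.\<close>

definition jt_row :: "(int \<Rightarrow> complex) \<Rightarrow> complex list \<Rightarrow> int \<Rightarrow> nat \<Rightarrow> complex" where
  "jt_row a xs k j = hA (shift (- int j) a) (k + 1 + int j) xs"

text \<open>The shifted sequence supplies the nodes a_(1-j), ..., a_p. Cut after a_0, they are the
  nodes of g_j in reverse order followed by those of f_p.\<close>

lemma jt_row_nonneg:
  "jt_row a xs (int p) j = poly_functional (\<lambda>m. hcomp m xs)
     (newton (\<lambda>i. a (int i + 1)) p * newton (\<lambda>i. a (- int i)) j)"
proof -
  let ?s = "\<lambda>i. shift (- int j) a (int i + 1)"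
  have "newton ?s j = newton (\<lambda>i. a (- int i)) j"
    by (subst newton_rev) (rule newton_cong, simp add: shift_def of_nat_diff)
  moreover have "newton (\<lambda>i. ?s (j + i)) p = newton (\<lambda>i. a (int i + 1)) p"
    by (rule newton_cong) (simp add: shift_def)
  ultimately have "newton ?s (j + p) = newton (\<lambda>i. a (int i + 1)) p * newton (\<lambda>i. a (- int i)) j"
    by (simp only: newton_add mult.commute)
  moreover have "int p + 1 + int j = int (Suc (j + p))" by simp
  ultimately show ?thesis
    unfolding jt_row_def by (simp only: hA_poly_functional)
qed

text \<open>The index of h is j - q. For j > q its nodes a_(1-j), ..., a_(-q-1) are those of g_j
  that are not nodes of g_(q+1), as in \<open>poly_operator_newton\<close>; the other cases make the
  matrix of these rows upper unitriangular.\<close>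

lemma jt_row_neg:
  "jt_row a xs (- int q - 1) j = (if j < q then 0 else if j = q then 1 else
     poly_functional (\<lambda>m. hcomp m xs) (newton (\<lambda>i. a (- int (Suc q + i))) (j - Suc q)))"
proof (cases "q < j")
  case True
  let ?s = "\<lambda>i. shift (- int j) a (int i + 1)"
  have "newton ?s (j - Suc q) = newton (\<lambda>i. a (- int (Suc q + i))) (j - Suc q)"
    by (subst newton_rev) (rule newton_cong, use True in \<open>simp add: shift_def of_nat_diff algebra_simps\<close>)
  moreover have "- int q - 1 + 1 + int j = int (Suc (j - Suc q))" using True by simp
  ultimately show ?thesis
    unfolding jt_row_def using True by (simp only: hA_poly_functional) simp
qed (auto simp: jt_row_def hA_def)

lemma poly_operator_newton_jt_row:
  assumes "j < N"
  shows "poly_operator (\<lambda>m. hcomp m xs) (newton (\<lambda>i. a (- int i)) j)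
    = (\<Sum>q<N. smult (jt_row a xs (- int q - 1) j) (newton (\<lambda>i. a (- int i)) q))"
proof -
  let ?f = "\<lambda>q. smult (jt_row a xs (- int q - 1) j) (newton (\<lambda>i. a (- int i)) q)"
  have h0: "hcomp 0 xs = 1" by (induction xs) auto
  have "sum ?f {..<N} = sum ?f {..<Suc j}"
    by (rule sum.mono_neutral_right) (use assms in \<open>auto simp: jt_row_neg\<close>)
  also have "\<dots> = newton (\<lambda>i. a (- int i)) j + sum ?f {..<j}"
    by (simp add: jt_row_neg add.commute)
  also have "sum ?f {..<j} = (\<Sum>q<j. smult (poly_functional (\<lambda>m. hcomp m xs)
      (newton (\<lambda>i. a (- int (Suc q + i))) (j - Suc q))) (newton (\<lambda>i. a (- int i)) q))"
    by (rule sum.cong) (auto simp: jt_row_neg)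
  finally show ?thesis
    using poly_operator_newton[of "\<lambda>m. hcomp m xs" "\<lambda>i. a (- int i)" j] h0 by simp
qed

text \<open>The rows with negative index form the matrix of \<open>poly_operator\<close> in a Newton basis, so changing
  the sequence conjugates that matrix by the transition matrix of the two bases.\<close>

lemma jt_row_neg_conjugate:
  fixes a b :: "int \<Rightarrow> complex"
  assumes "i < N" "j < N"
  defines "u \<equiv> \<lambda>i j. newton_coeff (\<lambda>i. a (- int i)) (\<lambda>i. b (- int i)) j i"
  shows "(\<Sum>q<N. u i q * jt_row a xs (- int q - 1) j) = (\<Sum>q<N. jt_row b xs (- int i - 1) q * u q j)"
proof -
  let ?g = "\<lambda>a. newton (\<lambda>i. a (- int i))"
  let ?A = "poly_operator (\<lambda>m. hcomp m xs)"
  have g: "?g a q = (\<Sum>i<N. smult (u i q) (?g b i))" if "q < N" for q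
    unfolding u_def by (rule newton_expansion_lessThan[OF that])
  have "(\<Sum>i<N. smult (\<Sum>q<N. u i q * jt_row a xs (- int q - 1) j) (?g b i))
      = (\<Sum>q<N. \<Sum>i<N. smult (u i q * jt_row a xs (- int q - 1) j) (?g b i))"
    by (subst sum.swap) (simp add: smult_sum)
  also have "\<dots> = (\<Sum>q<N. smult (jt_row a xs (- int q - 1) j) (?g a q))"
    by (rule sum.cong[OF refl])
       (simp add: g poly_eq_iff coeff_sum sum_distrib_left mult_ac)
  also have "\<dots> = ?A (?g a j)"
    by (rule poly_operator_newton_jt_row[OF assms(2), symmetric])
  also have "\<dots> = (\<Sum>q<N. smult (u q j) (?A (?g b q)))"
    by (subst g[OF assms(2)]) (simp add: poly_operator_sum poly_operator_smult)
  also have "\<dots> = (\<Sum>q<N. smult (u q j) (\<Sum>i<N. smult (jt_row b xs (- int i - 1) q) (?g b i)))"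
    by (rule sum.cong[OF refl]) (subst poly_operator_newton_jt_row[of _ N], auto)
  also have "\<dots> = (\<Sum>i<N. smult (\<Sum>q<N. jt_row b xs (- int i - 1) q * u q j) (?g b i))"
    by (simp add: poly_eq_iff coeff_sum sum_distrib_left sum_distrib_right)
       (subst sum.swap, simp add: mult_ac)
  finally show ?thesis by (rule newton_lin_indep[OF _ assms(1)])
qed

text \<open>Both factors of f_p g_j are expanded in the Newton bases of b, and L is linear.\<close>

lemma jt_row_nonneg_transition:
  fixes a b :: "int \<Rightarrow> complex"
  assumes "p < K" "j < N"
  defines "u \<equiv> \<lambda>i j. newton_coeff (\<lambda>i. a (- int i)) (\<lambda>i. b (- int i)) j i"
  shows "jt_row a xs (int p) j = (\<Sum>p'<K. \<Sum>i<N. cpp a b p p' * jt_row b xs (int p') i * u i j)"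
proof -
  let ?g = "\<lambda>a. newton (\<lambda>i. a (- int i))" and ?f = "\<lambda>a. newton (\<lambda>i. a (int i + 1))"
  have "?f a p * ?g a j = (\<Sum>p'<K. smult (cpp a b p p') (?f b p')) * (\<Sum>i<N. smult (u i j) (?g b i))"
    unfolding u_def cpp_eq_newton_coeff
    by (simp only: newton_expansion_lessThan[OF assms(1), symmetric] newton_expansion_lessThan[OF assms(2), symmetric])
  also have "\<dots> = (\<Sum>p'<K. \<Sum>i<N. smult (cpp a b p p' * u i j) (?f b p' * ?g b i))"
    by (simp only: sum_product mult_smult_left mult_smult_right smult_smult)
       (simp only: mult.commute)
  finally have "jt_row a xs (int p) j = (\<Sum>p'<K. \<Sum>i<N. cpp a b p p' * u i j * jt_row b xs (int p') i)"
    unfolding jt_row_nonneg by (simp only: poly_functional_sum poly_functional_smult)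
  then show ?thesis by (simp only: mult_ac)
qed

section \<open>Hooks and their change under a change of sequence\<close>

definition neg_mat :: "(int \<Rightarrow> complex) \<Rightarrow> complex list \<Rightarrow> nat \<Rightarrow> complex mat" where
  "neg_mat a xs N = mat N N (\<lambda>(q, j). jt_row a xs (- int q - 1) j)"

lemma neg_mat_carrier: "neg_mat a xs N \<in> carrier_mat N N"
  by (simp add: neg_mat_def)

lemma det_neg_mat: "det (neg_mat a xs N) = 1"
proof -
  have "upper_triangular (neg_mat a xs N)"
    by (rule upper_triangularI) (simp add: neg_mat_def jt_row_neg)
  then have "det (neg_mat a xs N) = prod_list (diag_mat (neg_mat a xs N))"
    by (rule det_upper_triangular) (rule neg_mat_carrier)
  also have "diag_mat (neg_mat a xs N) = replicate N 1"
    by (rule nth_equalityI) (auto simp: diag_mat_def neg_mat_def jt_row_neg)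
  finally show ?thesis by simp
qed

text \<open>For \<open>q < N\<close> this is \<open>s\<^sub>\<mu>\<^sub>;\<^sub>a\<close> for the hook \<open>\<mu> = (p | q)\<close>; it is obtained by normalising the
  rows with negative index to unit vectors.\<close>

definition hook :: "(int \<Rightarrow> complex) \<Rightarrow> complex list \<Rightarrow> nat \<Rightarrow> nat \<Rightarrow> nat \<Rightarrow> complex" where
  "hook a xs N p q = (-1) ^ q * (\<Sum>j<N. jt_row a xs (int p) j * adj_mat (neg_mat a xs N) $$ (j, q))"

lemma one_smult_mat: "(1 :: 'a :: monoid_mult) \<cdot>\<^sub>m A = A"
  by (rule eq_matI) auto

text \<open>The determinant is 1, so the adjugate is the inverse.\<close>

lemma neg_mat_inverse:
  "adj_mat (neg_mat a xs N) \<in> carrier_mat N N"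
  "neg_mat a xs N * adj_mat (neg_mat a xs N) = 1\<^sub>m N"
  "adj_mat (neg_mat a xs N) * neg_mat a xs N = 1\<^sub>m N"
  using adj_mat[OF neg_mat_carrier[of a xs N]] by (simp_all add: det_neg_mat one_smult_mat)

lemma sum_mat_mult_index:
  assumes "A \<in> carrier_mat n m" "B \<in> carrier_mat m k" "i < n" "j < k"
  shows "(A * B) $$ (i, j) = (\<Sum>l<m. A $$ (i, l) * B $$ (l, j))"
  using assms by (simp add: scalar_prod_def atLeast0LessThan)

text \<open>Up to sign, the hooks are the coordinates of a nonnegative row with respect to the
  negative rows; multiplying back by \<open>neg_mat\<close> recovers the row.\<close>

lemma jt_row_eq_hook:
  assumes "j < N"
  shows "jt_row a xs (int p) j = (\<Sum>q<N. (-1) ^ q * hook a xs N p q * jt_row a xs (- int q - 1) j)"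
proof -
  let ?G = "adj_mat (neg_mat a xs N)"
  have one: "(\<Sum>q<N. ?G $$ (i, q) * jt_row a xs (- int q - 1) j) = (if i = j then 1 else 0)" if "i < N" for i
  proof -
    have "(\<Sum>q<N. ?G $$ (i, q) * neg_mat a xs N $$ (q, j)) = (?G * neg_mat a xs N) $$ (i, j)"
      by (rule sum_mat_mult_index[symmetric]) (use that assms neg_mat_inverse in \<open>auto simp: neg_mat_def\<close>)
    then show ?thesis
      unfolding neg_mat_inverse(3) using that assms by (simp add: neg_mat_def)
  qed
  have "(\<Sum>q<N. (-1) ^ q * hook a xs N p q * jt_row a xs (- int q - 1) j)
    = (\<Sum>q<N. \<Sum>i<N. jt_row a xs (int p) i * (?G $$ (i, q) * jt_row a xs (- int q - 1) j))"
    by (simp add: hook_def sum_distrib_right mult.assoc)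
  also have "\<dots> = (\<Sum>i<N. jt_row a xs (int p) i * (\<Sum>q<N. ?G $$ (i, q) * jt_row a xs (- int q - 1) j))"
    by (subst sum.swap) (simp add: sum_distrib_left)
  also have "\<dots> = jt_row a xs (int p) j"
    using assms by (simp add: one if_distrib[of "\<lambda>x. _ * x"] cong: if_cong)
  finally show ?thesis ..
qed

text \<open>Let J be the nonnegative rows and M the negative ones. Then J_a = C J_b U and U M_a =
  M_b U, the latter giving U M_a^(-1) = M_b^(-1) U. Hence J_a M_a^(-1) = C (J_b M_b^(-1)) U, and the
  signs in \<open>hook\<close> turn U into the coefficients of the dual sequences.\<close>

lemma hook_transition:
  assumes "p < K" "q < N"
  shows "hook a xs N p q = (\<Sum>p'<K. \<Sum>q'<N. cpp a b p p' * hook b xs N p' q' * cpp (dual_seq a) (dual_seq b) q q')"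
proof -
  define u where "u = (\<lambda>i j. newton_coeff (\<lambda>i. a (- int i)) (\<lambda>i. b (- int i)) j i)"
  define U where "U = mat N N (\<lambda>(i, j). u i j)"
  let ?Ga = "adj_mat (neg_mat a xs N)" and ?Gb = "adj_mat (neg_mat b xs N)"
  have carr: "U \<in> carrier_mat N N" "neg_mat a xs N \<in> carrier_mat N N" "neg_mat b xs N \<in> carrier_mat N N"
    "?Ga \<in> carrier_mat N N" "?Gb \<in> carrier_mat N N"
    using neg_mat_inverse by (auto simp: U_def neg_mat_carrier)
  have "U * neg_mat a xs N = neg_mat b xs N * U"
  proof (rule eq_matI)
    fix i j assume "i < dim_row (neg_mat b xs N * U)" "j < dim_col (neg_mat b xs N * U)"
    then have ij: "i < N" "j < N" using carr by auto
    then show "(U * neg_mat a xs N) $$ (i, j) = (neg_mat b xs N * U) $$ (i, j)"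
      unfolding sum_mat_mult_index[OF carr(1,2) ij] sum_mat_mult_index[OF carr(3,1) ij]
      using jt_row_neg_conjugate[OF ij, of a b xs] by (simp add: U_def neg_mat_def u_def)
  qed (use carr in auto)
  then have "?Gb * (U * neg_mat a xs N) * ?Ga = ?Gb * (neg_mat b xs N * U) * ?Ga"
    by simp
  moreover have "?Gb * (U * neg_mat a xs N) * ?Ga = ?Gb * (U * (neg_mat a xs N * ?Ga))"
    using carr by (simp add: assoc_mult_mat[of _ N N _ N _ N])
  moreover have "?Gb * (neg_mat b xs N * U) * ?Ga = (?Gb * neg_mat b xs N) * (U * ?Ga)"
    using carr by (simp add: assoc_mult_mat[of _ N N _ N _ N])
  ultimately have GU: "?Gb * U = U * ?Ga"
    using carr neg_mat_inverse(2,3) by simp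
  have conj: "(\<Sum>j<N. u i j * ?Ga $$ (j, q)) = (\<Sum>q'<N. ?Gb $$ (i, q') * u q' q)" if "i < N" for i
  proof -
    have "(U * ?Ga) $$ (i, q) = (?Gb * U) $$ (i, q)" by (simp add: GU)
    then show ?thesis
      unfolding sum_mat_mult_index[OF carr(1,4) that assms(2)] sum_mat_mult_index[OF carr(5,1) that assms(2)]
      using that assms(2) by (simp add: U_def)
  qed
  have "hook a xs N p q = (-1) ^ q * (\<Sum>j<N. (\<Sum>p'<K. \<Sum>i<N. cpp a b p p' * jt_row b xs (int p') i * u i j) * ?Ga $$ (j, q))"
    unfolding hook_def u_def
    by (rule arg_cong[of _ _ "(*) _"], rule sum.cong[OF refl], rule arg_cong[of _ _ "\<lambda>x. x * _"],
        rule jt_row_nonneg_transition[OF assms(1)]) simp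
  also have "(\<Sum>j<N. (\<Sum>p'<K. \<Sum>i<N. cpp a b p p' * jt_row b xs (int p') i * u i j) * ?Ga $$ (j, q))
    = (\<Sum>p'<K. \<Sum>i<N. \<Sum>j<N. cpp a b p p' * jt_row b xs (int p') i * (u i j * ?Ga $$ (j, q)))"
    unfolding sum_distrib_right
    by (subst sum.swap, rule sum.cong[OF refl], subst sum.swap) (simp add: mult.assoc)
  also have "\<dots> = (\<Sum>p'<K. \<Sum>i<N. cpp a b p p' * jt_row b xs (int p') i * (\<Sum>q'<N. ?Gb $$ (i, q') * u q' q))"
    by (simp only: sum_distrib_left[symmetric]) (simp add: conj)
  also have "\<dots> = (\<Sum>p'<K. \<Sum>q'<N. cpp a b p p' * (\<Sum>i<N. jt_row b xs (int p') i * ?Gb $$ (i, q')) * u q' q)"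
    unfolding sum_distrib_left sum_distrib_right
    by (rule sum.cong[OF refl], subst sum.swap) (simp add: mult.assoc)
  finally have "hook a xs N p q = (\<Sum>p'<K. \<Sum>q'<N. (-1) ^ q *
      (cpp a b p p' * (\<Sum>i<N. jt_row b xs (int p') i * ?Gb $$ (i, q')) * u q' q))"
    by (simp only: sum_distrib_left)
  \<comment> \<open>The sign q is redistributed as q' for the hook of b and q + q' for the dual
    coefficient.\<close>
  moreover have "(-1) ^ q * (c * s * v) = c * ((-1) ^ q' * s) * ((-1) ^ (q + q') * v)"
    for c s v :: complex and q'
    by (cases "even q"; cases "even q'") (simp_all add: power_add)
  ultimately show ?thesis
    by (simp only: cpp_dual_eq_newton_coeff hook_def u_def)
qed

section \<open>Determinants\<close>

definition decreasing_lists :: "nat \<Rightarrow> nat \<Rightarrow> nat list set" where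
  "decreasing_lists K d = {ks. length ks = d \<and> sorted_wrt (>) ks \<and> set ks \<subseteq> {..<K}}"

lemma finite_decreasing_lists: "finite (decreasing_lists K d)"
  by (rule finite_subset[OF _ finite_lists_length_eq[of "{..<K}" d]]) (auto simp: decreasing_lists_def)

lemma decreasing_list_unique:
  fixes xs ys :: "'a :: linorder list"
  assumes "sorted_wrt (>) xs" "sorted_wrt (>) ys" "set xs = set ys"
  shows "xs = ys"
proof -
  have "rev xs = rev ys"
    by (rule strict_sorted_equal) (use assms in \<open>auto simp: sorted_wrt_rev\<close>)
  then show ?thesis by simp
qed

lemma decreasing_list_distinct: "sorted_wrt (>) (xs :: 'a :: linorder list) \<Longrightarrow> distinct xs"
  by (induction xs) auto

text \<open>An injective choice of d indices is its image, sorted decreasingly, together with the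
  permutation recording the order of choice.\<close>

lemma bij_betw_injections:
  "bij_betw (\<lambda>(ks, s). restrict (\<lambda>i. ks ! s i) {0..<d})
     (decreasing_lists K d \<times> {s. s permutes {0..<d}})
     {f \<in> {0..<d} \<rightarrow>\<^sub>E {..<K}. inj_on f {0..<d}}"
  unfolding bij_betw_def
proof
  let ?\<Phi> = "\<lambda>(ks, s). restrict (\<lambda>i. ks ! s i) {0..<d}"
  let ?X = "decreasing_lists K d \<times> {s. s permutes {0..<d}}"
  have nthinj: "inj_on ((!) ks) {0..<d}" if "ks \<in> decreasing_lists K d" for ks
    using that decreasing_list_distinct[of ks]
    by (auto simp: decreasing_lists_def inj_on_def nth_eq_iff_index_eq)
  have img: "(\<lambda>i. ks ! s i) ` {0..<d} = set ks"
    if "ks \<in> decreasing_lists K d" "s permutes {0..<d}" for ks s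
  proof -
    have "(\<lambda>i. ks ! s i) ` {0..<d} = (!) ks ` (s ` {0..<d})" by auto
    then show ?thesis
      using permutes_image[OF that(2)] that(1) by (auto simp: decreasing_lists_def set_conv_nth)
  qed
  show "inj_on ?\<Phi> ?X"
  proof (rule inj_onI, clarify)
    fix ks s ks' s'
    assume a: "ks \<in> decreasing_lists K d" "s permutes {0..<d}" "ks' \<in> decreasing_lists K d" "s' permutes {0..<d}"
      and eq: "restrict (\<lambda>i. ks ! s i) {0..<d} = restrict (\<lambda>i. ks' ! s' i) {0..<d}"
    have eq': "ks ! s i = ks' ! s' i" if "i < d" for i
      using fun_cong[OF eq, of i] that by simp
    then have "set ks = set ks'"
      using img[OF a(1,2)] img[OF a(3,4)] by (metis (no_types, lifting) atLeastLessThan_iff image_cong)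
    then have ks: "ks = ks'"
      using a by (auto simp: decreasing_lists_def intro: decreasing_list_unique)
    have "s i = s' i" for i
    proof (cases "i < d")
      case True
      then have "s i < d" "s' i < d"
        using permutes_in_image[OF a(2), of i] permutes_in_image[OF a(4), of i] by auto
      then show ?thesis
        using inj_onD[OF nthinj[OF a(1)], of "s i" "s' i"] eq'[OF True] ks by simp
    next
      case False
      then show ?thesis
        using permutes_not_in[OF a(2), of i] permutes_not_in[OF a(4), of i] by simp
    qed
    with ks show "ks = ks' \<and> s = s'" by auto
  qed
  show "?\<Phi> ` ?X = {f \<in> {0..<d} \<rightarrow>\<^sub>E {..<K}. inj_on f {0..<d}}"
  proof (intro equalityI subsetI)
    fix f assume "f \<in> ?\<Phi> ` ?X"
    then obtain ks s where ks: "ks \<in> decreasing_lists K d" and s: "s permutes {0..<d}"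
      and f: "f = restrict (\<lambda>i. ks ! s i) {0..<d}" by auto
    have "inj_on (\<lambda>i. ks ! s i) {0..<d}"
      using comp_inj_on[OF permutes_inj_on[OF s, of "{0..<d}"], of "(!) ks"] nthinj[OF ks]
      by (simp add: permutes_image[OF s] o_def)
    moreover have "set ks \<subseteq> {..<K}" using ks by (auto simp: decreasing_lists_def)
    then have "ks ! s i < K" if "i < d" for i
      using img[OF ks s] that by auto
    ultimately show "f \<in> {f \<in> {0..<d} \<rightarrow>\<^sub>E {..<K}. inj_on f {0..<d}}"
      by (auto simp: f inj_on_def)
  next
    fix f assume "f \<in> {f \<in> {0..<d} \<rightarrow>\<^sub>E {..<K}. inj_on f {0..<d}}"
    then have f: "f \<in> {0..<d} \<rightarrow>\<^sub>E {..<K}" and inj: "inj_on f {0..<d}" by auto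
    define ks where "ks = rev (sorted_list_of_set (f ` {0..<d}))"
    have set: "set ks = f ` {0..<d}" by (simp add: ks_def)
    have "length ks = d"
      by (simp add: ks_def card_image[OF inj])
    moreover have "sorted_wrt (>) ks"
      by (simp add: ks_def sorted_wrt_rev)
    ultimately have ks: "ks \<in> decreasing_lists K d"
      using f set by (auto simp: decreasing_lists_def)
    \<comment> \<open>s sends i to the position of f i in the sorted list; the identity outside the
      range is what \<open>permutes\<close> demands.\<close>
    define s where "s = (\<lambda>i. if i < d then inv_into {0..<d} ((!) ks) (f i) else i)"
    have nthset: "(!) ks ` {0..<d} = f ` {0..<d}"
      unfolding set[symmetric] using \<open>length ks = d\<close> by (auto simp: set_conv_nth)
    have ks_s: "ks ! s i = f i" "s i < d" if "i < d" for i
    proof -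
      have "f i \<in> (!) ks ` {0..<d}" using that nthset by auto
      then show "ks ! s i = f i" "s i < d"
        using that f_inv_into_f[of "f i" "(!) ks" "{0..<d}"] inv_into_into[of "f i" "(!) ks" "{0..<d}"]
        by (auto simp: s_def)
    qed
    have "inj_on s {0..<d}"
      by (rule inj_onI) (metis atLeastLessThan_iff inj inj_onD ks_s(1))
    then have "s ` {0..<d} = {0..<d}"
      by (intro endo_inj_surj) (auto simp: ks_s)
    with \<open>inj_on s {0..<d}\<close> have "bij_betw s {0..<d} {0..<d}" by (simp add: bij_betw_def)
    then have "s permutes {0..<d}"
      by (rule bij_imp_permutes) (simp add: s_def)
    moreover have "f = restrict (\<lambda>i. ks ! s i) {0..<d}"
      using f ks_s by (auto simp: fun_eq_iff PiE_def extensional_def restrict_def)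
    ultimately show "f \<in> ?\<Phi> ` ?X" using ks by force
  qed
qed

text \<open>Multilinearity in the rows gives a sum over all choices of one index per row. A repeated
  index produces two equal rows, and the injective choices are split by
  \<open>bij_betw_injections\<close>.\<close>

lemma cauchy_binet:
  fixes A B :: "nat \<Rightarrow> nat \<Rightarrow> 'a :: comm_ring_1"
  shows "det (mat d d (\<lambda>(i, j). \<Sum>k<K. A i k * B k j)) =
    (\<Sum>ks\<in>decreasing_lists K d.
       det (mat d d (\<lambda>(i, t). A i (ks ! t))) * det (mat d d (\<lambda>(t, j). B (ks ! t) j)))"
proof -
  let ?P = "{s. s permutes {0..<d}}" and ?F = "{0..<d} \<rightarrow>\<^sub>E {..<K}"
  let ?I = "{f \<in> ?F. inj_on f {0..<d}}"
  define g where "g f = (\<Prod>i=0..<d. A i (f i)) * det (mat d d (\<lambda>(i, j). B (f i) j))" for f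
  have perm_lt: "s i < d" if "s permutes {0..<d}" "i < d" for s i
    using permutes_in_image[OF that(1), of i] that(2) by auto
  have "det (mat d d (\<lambda>(i, j). \<Sum>k<K. A i k * B k j)) =
     (\<Sum>s\<in>?P. signof s * (\<Prod>i=0..<d. \<Sum>k<K. A i k * B k (s i)))"
    by (subst det_def'[of _ d]) (auto simp: perm_lt intro!: sum.cong prod.cong)
  also have "\<dots> = (\<Sum>s\<in>?P. signof s * (\<Sum>f\<in>?F. (\<Prod>i=0..<d. A i (f i)) * (\<Prod>i=0..<d. B (f i) (s i))))"
    by (simp add: prod_sum_PiE prod.distrib)
  also have "\<dots> = (\<Sum>f\<in>?F. (\<Prod>i=0..<d. A i (f i)) * (\<Sum>s\<in>?P. signof s * (\<Prod>i=0..<d. B (f i) (s i))))"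
    unfolding sum_distrib_left by (subst sum.swap) (simp add: mult_ac)
  also have "\<dots> = sum g ?F"
    unfolding g_def
    by (rule sum.cong[OF refl], subst det_def'[of _ d])
       (auto simp: perm_lt intro!: arg_cong2[of _ _ _ _ "(*)"] sum.cong prod.cong)
  also have "\<dots> = sum g ?I"
  proof (rule sum.mono_neutral_right)
    show "finite ?F" by (auto intro: finite_PiE)
    show "\<forall>f\<in>?F - ?I. g f = 0"
    proof
      fix f assume "f \<in> ?F - ?I"
      then obtain i j where ij: "i < d" "j < d" "i \<noteq> j" "f i = f j"
        by (auto simp: inj_on_def)
      have "det (mat d d (\<lambda>(i, j). B (f i) j)) = 0"
        by (rule det_identical_rows[of _ d i j]) (use ij in \<open>auto simp: row_def\<close>)
      then show "g f = 0" by (simp add: g_def)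
    qed
  qed auto
  also have "\<dots> = (\<Sum>(ks, s)\<in>decreasing_lists K d \<times> ?P. g (restrict (\<lambda>i. ks ! s i) {0..<d}))"
    by (subst sum.reindex_bij_betw[OF bij_betw_injections, symmetric]) (simp add: case_prod_beta)
  also have "\<dots> = (\<Sum>ks\<in>decreasing_lists K d. \<Sum>s\<in>?P.
      signof s * (\<Prod>i=0..<d. A i (ks ! s i)) * det (mat d d (\<lambda>(t, j). B (ks ! t) j)))"
    unfolding sum.cartesian_product[symmetric]
  proof (intro sum.cong[OF refl])
    fix ks s assume "s \<in> ?P"
    then have s: "s permutes {0..<d}" by simp
    have "mat d d (\<lambda>(i, j). B (restrict (\<lambda>i. ks ! s i) {0..<d} i) j)
        = mat d d (\<lambda>(i, j). mat d d (\<lambda>(t, j). B (ks ! t) j) $$ (s i, j))"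
      by (rule eq_matI) (auto simp: perm_lt[OF s])
    then have "det (mat d d (\<lambda>(i, j). B (restrict (\<lambda>i. ks ! s i) {0..<d} i) j))
        = signof s * det (mat d d (\<lambda>(t, j). B (ks ! t) j))"
      using det_permute_rows[OF _ s, of "mat d d (\<lambda>(t, j). B (ks ! t) j)"] by simp
    then show "g (restrict (\<lambda>i. ks ! s i) {0..<d}) =
       signof s * (\<Prod>i=0..<d. A i (ks ! s i)) * det (mat d d (\<lambda>(t, j). B (ks ! t) j))"
      unfolding g_def by (simp add: mult_ac)
  qed
  \<comment> \<open>The inner sum over permutations is the Leibniz expansion of the minor of
    A.\<close>
  also have "\<dots> = (\<Sum>ks\<in>decreasing_lists K d.
       det (mat d d (\<lambda>(i, t). A i (ks ! t))) * det (mat d d (\<lambda>(t, j). B (ks ! t) j)))"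
    by (rule sum.cong[OF refl], subst (2) det_def'[of _ d])
       (auto simp: perm_lt sum_distrib_right intro!: sum.cong arg_cong2[of _ _ _ _ "(*)"] prod.cong)
  finally show ?thesis .
qed

text \<open>The alternating signs in the first rows absorb the sign of the permutation that sorts the columns.\<close>

lemma det_unit_rows:
  fixes G :: "nat \<Rightarrow> nat \<Rightarrow> 'a :: comm_ring_1"
  assumes "sorted_wrt (>) qs" "set qs \<subseteq> {..<N}"
  shows "det (mat N N (\<lambda>(i, j). if i < length qs then (-1) ^ j * G i j
           else if j = filter (\<lambda>r. r \<notin> set qs) [0..<N] ! (i - length qs) then 1 else 0))
       = det (mat (length qs) (length qs) (\<lambda>(i, t). G i (qs ! t)))"
  using assms
proof (induction N arbitrary: G qs)
  case 0
  then show ?case by simp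
next
  case (Suc N)
  let ?R = "\<lambda>qs N. filter (\<lambda>r. r \<notin> set qs) [0..<N]"
  let ?M = "\<lambda>qs N G. mat N N (\<lambda>(i, j). if i < length qs then (-1) ^ j * G i j
      else if j = ?R qs N ! (i - length qs) then 1 else (0 :: 'a))"
  let ?A = "?M qs (Suc N) G"
  have lenR: "length (?R qs N) = N - length qs" if "sorted_wrt (>) qs" "set qs \<subseteq> {..<N}" for qs N
  proof -
    have "length (?R qs N) = card (set (?R qs N))"
      by (metis distinct_card distinct_filter distinct_upt)
    also have "set (?R qs N) = {..<N} - set qs" by auto
    also have "card \<dots> = N - length qs"
      using that decreasing_list_distinct[of qs] by (simp add: card_Diff_subset distinct_card)
    finally show ?thesis .
  qed
  have len_le: "length qs \<le> N" if "sorted_wrt (>) qs" "set qs \<subseteq> {..<N}" for qs N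
    using card_mono[OF _ that(2)] distinct_card[OF decreasing_list_distinct[OF that(1)]] by simp
  show ?case
  proof (cases "N \<in> set qs")
    case False
    with Suc.prems have sub: "set qs \<subseteq> {..<N}" by (auto simp: less_Suc_eq)
    let ?d = "length qs"
    note d = len_le[OF Suc.prems(1) sub]
    \<comment> \<open>Column N is not selected, so the last row is the unit vector with its 1 in the
      last column; expanding along that row removes both.\<close>
    have R: "?R qs (Suc N) = ?R qs N @ [N]" using False by simp
    have last: "?R qs (Suc N) ! (N - ?d) = N"
      unfolding R using lenR[OF Suc.prems(1) sub] by (metis nth_append_length)
    have "det ?A = (\<Sum>j<Suc N. ?A $$ (N, j) * cofactor ?A N j)"
      by (rule laplace_expansion_row) auto
    also have "\<dots> = (\<Sum>j<Suc N. if j = N then cofactor ?A N j else 0)"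
      using d last by (intro sum.cong) auto
    also have "\<dots> = cofactor ?A N N" by simp
    also have "\<dots> = det (mat_delete ?A N N)" by (simp add: cofactor_def)
    also have "mat_delete ?A N N = ?M qs N G"
    proof (rule eq_matI)
      fix i j assume ij: "i < dim_row (?M qs N G)" "j < dim_col (?M qs N G)"
      then have "?R qs (Suc N) ! (i - ?d) = ?R qs N ! (i - ?d)" if "\<not> i < ?d"
        unfolding R using lenR[OF Suc.prems(1) sub] that by (intro nth_append_left) auto
      with ij show "mat_delete ?A N N $$ (i, j) = ?M qs N G $$ (i, j)"
        by (auto simp: mat_delete_def)
    qed (auto simp: mat_delete_def)
    also have "det (?M qs N G) = det (mat ?d ?d (\<lambda>(i, t). G i (qs ! t)))"
      by (rule Suc.IH[OF Suc.prems(1) sub])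
    finally show ?thesis .
  next
    case True
    \<comment> \<open>Column N is selected, hence it heads the decreasing list. All unit rows vanish
      in it, so the expansion along this column involves only the first rows.\<close>
    then obtain q qs' where qs: "qs = q # qs'" by (cases qs) auto
    with True Suc.prems have q: "q = N" by fastforce
    have srt: "sorted_wrt (>) qs'" and sub: "set qs' \<subseteq> {..<N}"
      using Suc.prems qs q by auto
    let ?d = "length qs'"
    note d = len_le[OF srt sub]
    have R: "?R qs (Suc N) = ?R qs' N"
      by (auto simp: qs q intro: filter_cong)
    define A where "A = mat (Suc N) (Suc N) (\<lambda>(i, j). if i < Suc ?d then (-1) ^ j * G i j
      else if j = ?R qs' N ! (i - Suc ?d) then 1 else (0 :: 'a))"
    have len: "length qs = Suc ?d" by (simp add: qs)
    have A: "?A = A" unfolding A_def R len ..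
    have R_lt: "?R qs' N ! k < N" if "k < N - ?d" for k
    proof -
      have "?R qs' N ! k \<in> set (?R qs' N)" using lenR[OF srt sub] that by (intro nth_mem) simp
      then show ?thesis by simp
    qed
    \<comment> \<open>Deleting such a row leaves a matrix of the same shape with G reindexed, which
      is why the induction keeps G arbitrary.\<close>
    have del: "det (mat_delete A i N) = det (mat ?d ?d (\<lambda>(k, t). G (insert_index i k) (qs' ! t)))"
      if "i < Suc ?d" for i
    proof -
      have "mat_delete A i N = ?M qs' N (\<lambda>k. G (insert_index i k))"
        by (rule eq_matI) (use that d in \<open>auto simp: mat_delete_def A_def insert_index_def\<close>)
      then show ?thesis using Suc.IH[OF srt sub] by simp
    qed
    have "det A = (\<Sum>i<Suc N. A $$ (i, N) * cofactor A i N)"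
      by (rule laplace_expansion_column) (auto simp: A_def)
    also have "\<dots> = (\<Sum>i<Suc ?d. A $$ (i, N) * cofactor A i N)"
    proof (rule sum.mono_neutral_right)
      show "\<forall>i\<in>{..<Suc N} - {..<Suc ?d}. A $$ (i, N) * cofactor A i N = 0"
      proof
        fix i assume i: "i \<in> {..<Suc N} - {..<Suc ?d}"
        then have "?R qs' N ! (i - Suc ?d) < N" by (intro R_lt) auto
        then have "A $$ (i, N) = 0" using i by (simp add: A_def)
        then show "A $$ (i, N) * cofactor A i N = 0" by simp
      qed
    qed (use d in auto)
    also have "\<dots> = (\<Sum>i<Suc ?d. G i N * ((-1) ^ i * det (mat ?d ?d (\<lambda>(k, t). G (insert_index i k) (qs' ! t)))))"
    proof (rule sum.cong[OF refl])
      fix i assume i: "i \<in> {..<Suc ?d}"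
      then have "A $$ (i, N) = (-1) ^ N * G i N" using d by (simp add: A_def)
      moreover have "cofactor A i N = (-1) ^ (i + N) * det (mat ?d ?d (\<lambda>(k, t). G (insert_index i k) (qs' ! t)))"
        using del i by (simp add: cofactor_def)
      \<comment> \<open>The sign of the entry cancels the column sign of the cofactor. What remains
        is (-1)^i, the cofactor sign for the column 0 that N occupies in the minor.\<close>
      moreover have "(-1) ^ N * g * ((-1) ^ (i + N) * x) = g * ((-1) ^ i * x)" for g x :: 'a
        by (cases "even N"; cases "even i") (simp_all add: power_add)
      ultimately show "A $$ (i, N) * cofactor A i N
          = G i N * ((-1) ^ i * det (mat ?d ?d (\<lambda>(k, t). G (insert_index i k) (qs' ! t))))"
        by simp
    qed
    also have "\<dots> = det (mat (Suc ?d) (Suc ?d) (\<lambda>(i, t). G i (qs ! t)))" (is "_ = det ?B")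
    proof -
      have "det ?B = (\<Sum>i<Suc ?d. ?B $$ (i, 0) * cofactor ?B i 0)"
        by (rule laplace_expansion_column) auto
      moreover have "mat_delete ?B i 0 = mat ?d ?d (\<lambda>(k, t). G (insert_index i k) (qs' ! t))" for i
        by (rule eq_matI) (auto simp: mat_delete_def insert_index_def qs)
      ultimately show ?thesis by (simp add: cofactor_def qs q)
    qed
    finally show ?thesis unfolding A by (simp add: qs)
  qed
qed

text \<open>Some Leibniz term is nonzero, so a permutation s has ps' (s i) \<le> ps i for all i.
  Some i \<ge> k has s i \<le> k, and monotonicity gives ps' k \<le> ps' (s i) \<le> ps i \<le> ps
  k.\<close>

lemma det_triangular_nonzero_imp_le:
  fixes c :: "nat \<Rightarrow> nat \<Rightarrow> 'a :: comm_ring_1"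
  assumes c: "\<And>p p'. p < p' \<Longrightarrow> c p p' = 0"
    and ps: "\<And>i j. i \<le> j \<Longrightarrow> j < d \<Longrightarrow> ps j \<le> ps i"
    and ps': "\<And>i j. i \<le> j \<Longrightarrow> j < d \<Longrightarrow> ps' j \<le> ps' i"
    and nz: "det (mat d d (\<lambda>(i, j). c (ps i) (ps' j))) \<noteq> 0"
    and k: "k < d"
  shows "ps' k \<le> (ps k :: nat)"
proof -
  have "(\<Sum>s | s permutes {0..<d}. signof s * (\<Prod>i=0..<d. mat d d (\<lambda>(i, j). c (ps i) (ps' j)) $$ (i, s i))) \<noteq> 0"
    using nz by (subst (asm) det_def'[of _ d]) auto
  then obtain s where s: "s permutes {0..<d}"
    and "signof s * (\<Prod>i=0..<d. mat d d (\<lambda>(i, j). c (ps i) (ps' j)) $$ (i, s i)) \<noteq> 0"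
    by (auto elim: sum.not_neutral_contains_not_neutral)
  then have nz: "(\<Prod>i=0..<d. mat d d (\<lambda>(i, j). c (ps i) (ps' j)) $$ (i, s i)) \<noteq> 0" by auto
  have s_lt: "s i < d" if "i < d" for i using permutes_in_image[OF s, of i] that by auto
  have le: "ps' (s i) \<le> ps i" if "i < d" for i
  proof (rule ccontr)
    assume "\<not> ?thesis"
    then have "mat d d (\<lambda>(i, j). c (ps i) (ps' j)) $$ (i, s i) = 0" using that s_lt c by simp
    then have "(\<Prod>i=0..<d. mat d d (\<lambda>(i, j). c (ps i) (ps' j)) $$ (i, s i)) = 0"
      using that by (intro prod_zero bexI[of _ i]) auto
    with nz show False by simp
  qed
  \<comment> \<open>Pigeonhole: the d - k rows from k on cannot be sent injectively into the d - k -
    1 columns after k.\<close>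
  have "\<exists>i\<in>{k..<d}. s i \<le> k"
  proof (rule ccontr)
    assume "\<not> ?thesis"
    then have "s ` {k..<d} \<subseteq> {Suc k..<d}" using s_lt by force
    then have "card (s ` {k..<d}) \<le> card {Suc k..<d}" by (intro card_mono) auto
    moreover have "card (s ` {k..<d}) = d - k" using permutes_inj_on[OF s] by (simp add: card_image)
    ultimately show False using k by simp
  qed
  then obtain i where i: "k \<le> i" "i < d" "s i \<le> k" by auto
  then have "ps' k \<le> ps' (s i)" using ps' k by simp
  also have "\<dots> \<le> ps i" using le i by simp
  also have "\<dots> \<le> ps k" using ps i by simp
  finally show ?thesis .
qed

lemma det_unitriangular:
  fixes c :: "nat \<Rightarrow> nat \<Rightarrow> 'a :: comm_ring_1"
  assumes "\<And>p p'. p < p' \<Longrightarrow> c p p' = 0" "\<And>p. c p p = 1"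
    and "\<And>i j. i < j \<Longrightarrow> j < d \<Longrightarrow> ps j < ps i"
  shows "det (mat d d (\<lambda>(i, j). c (ps i) (ps j))) = 1"
proof -
  let ?M = "mat d d (\<lambda>(i, j). c (ps i) (ps j))"
  have "det ?M = prod_list (diag_mat ?M)"
    by (rule det_upper_triangular[of _ d]) (use assms in auto)
  also have "diag_mat ?M = replicate d 1"
    by (rule nth_equalityI) (auto simp: diag_mat_def assms)
  finally show ?thesis by simp
qed

section \<open>Partitions and Frobenius coordinates\<close>

text \<open>Padding with zeros allows comparison at every index and Jacobi-Trudi matrices of any
  size at least the length.\<close>

definition part :: "nat list \<Rightarrow> nat \<Rightarrow> nat" where
  "part mu i = (if i < length mu then mu ! i else 0)"

lemma part_antimono:
  assumes "is_partition mu" "i \<le> j"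
  shows "part mu j \<le> part mu i"
proof (cases "i = j \<or> length mu \<le> j")
  case False
  then show ?thesis
    using assms sorted_wrt_nth_less[of "\<lambda>x y. y \<le> x" mu i j] by (auto simp: part_def is_partition_def)
qed (auto simp: part_def)

lemma part_pos_iff: "is_partition mu \<Longrightarrow> 0 < part mu i \<longleftrightarrow> i < length mu"
  by (auto simp: part_def is_partition_def)

lemma part_eq_imp_eq:
  assumes "is_partition mu" "is_partition nu" "\<And>i. part mu i = part nu i"
  shows "mu = nu"
proof -
  have "i < length mu \<longleftrightarrow> i < length nu" for i
    using part_pos_iff[OF assms(1), of i] part_pos_iff[OF assms(2), of i] assms(3) by simp
  then have "length mu = length nu" by (metis linorder_neqE_nat less_irrefl)
  then show ?thesis
    using assms(3) by (intro nth_equalityI) (auto simp: part_def, metis)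
qed

lemma subpart_iff:
  assumes "is_partition mu" "is_partition nu"
  shows "subpart nu mu \<longleftrightarrow> (\<forall>i. part nu i \<le> part mu i)"
proof
  assume "\<forall>i. part nu i \<le> part mu i"
  moreover from this have "i < length mu" if "i < length nu" for i
    using that part_pos_iff[OF assms(1), of i] part_pos_iff[OF assms(2), of i]
    by (metis gr0I leD)
  then have "length nu \<le> length mu" by (meson le_less_linear less_irrefl)
  ultimately show "subpart nu mu"
    by (auto simp: subpart_def part_def split: if_splits)
qed (auto simp: subpart_def part_def)

text \<open>Turns the cardinalities in \<open>dnum\<close> and \<open>conj_part\<close> into
  inequalities on the parts.\<close>

lemma card_initial_segment:
  fixes S :: "nat set"
  assumes "finite S" "\<And>i j. j \<in> S \<Longrightarrow> i \<le> j \<Longrightarrow> i \<in> S"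
  shows "i \<in> S \<longleftrightarrow> i < card S"
proof
  assume "i \<in> S"
  then have "{..i} \<subseteq> S" using assms(2) by auto
  from card_mono[OF assms(1) this] show "i < card S" by simp
next
  assume i: "i < card S"
  show "i \<in> S"
  proof (rule ccontr)
    assume "i \<notin> S"
    then have "S \<subseteq> {..<i}" using assms(2) by (meson lessThan_iff linorder_not_less subsetI)
    from card_mono[OF _ this] i show False by simp
  qed
qed

lemma less_dnum_iff:
  assumes "is_partition mu"
  shows "i < dnum mu \<longleftrightarrow> i < part mu i"
proof -
  have eq: "{i. i < length mu \<and> i < mu ! i} = {i. i < part mu i}"
    by (auto simp: part_def split: if_splits)
  have "i \<in> {i. i < part mu i} \<longleftrightarrow> i < card {i. i < part mu i}"
  proof (rule card_initial_segment)
    have "{i. i < part mu i} \<subseteq> {..<length mu}" by (auto simp: part_def split: if_splits)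
    then show "finite {i. i < part mu i}" by (rule finite_subset) simp
  next
    fix i j assume "j \<in> {i. i < part mu i}" "i \<le> j"
    then show "i \<in> {i. i < part mu i}" using part_antimono[OF assms, of i j] by simp
  qed
  then show ?thesis by (simp add: dnum_def eq)
qed

lemma less_conj_part_iff:
  assumes "is_partition mu" "0 < j"
  shows "i < conj_part mu j \<longleftrightarrow> j \<le> part mu i"
proof -
  have eq: "{k. k < length mu \<and> j \<le> mu ! k} = {k. j \<le> part mu k}"
    using assms(2) by (auto simp: part_def split: if_splits)
  have "i \<in> {k. j \<le> part mu k} \<longleftrightarrow> i < card {k. j \<le> part mu k}"
  proof (rule card_initial_segment)
    have "{k. j \<le> part mu k} \<subseteq> {..<length mu}" using assms(2) by (auto simp: part_def split: if_splits)
    then show "finite {k. j \<le> part mu k}" by (rule finite_subset) simp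
  next
    fix i l assume "l \<in> {k. j \<le> part mu k}" "i \<le> l"
    then show "i \<in> {k. j \<le> part mu k}" using part_antimono[OF assms(1), of i l] by simp
  qed
  then show ?thesis by (simp add: conj_part_def eq)
qed

lemma frob_p_eq:
  assumes "is_partition mu" "i < dnum mu"
  shows "part mu i = frob_p mu i + i + 1"
  using assms less_dnum_iff[of mu i] by (auto simp: frob_p_def part_def split: if_splits)

lemma frob_q_eq:
  assumes "is_partition mu" "i < dnum mu"
  shows "conj_part mu (i + 1) = frob_q mu i + i + 1"
  using assms less_dnum_iff[of mu i] less_conj_part_iff[of mu "i + 1" i] by (auto simp: frob_q_def)

lemma frob_p_less:
  assumes "is_partition mu" "i < j" "j < dnum mu"
  shows "frob_p mu j < frob_p mu i"
  using assms frob_p_eq[of mu i] frob_p_eq[of mu j] part_antimono[of mu i j] by simp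

lemma frob_q_less:
  assumes "is_partition mu" "i < j" "j < dnum mu"
  shows "frob_q mu j < frob_q mu i"
proof -
  have "conj_part mu (j + 1) \<le> conj_part mu (i + 1)"
  proof (rule ccontr)
    assume "\<not> ?thesis"
    then have "conj_part mu (i + 1) < conj_part mu (j + 1)" by simp
    then have "j + 1 \<le> part mu (conj_part mu (i + 1))"
      using less_conj_part_iff[OF assms(1)] by simp
    then have "conj_part mu (i + 1) < conj_part mu (i + 1)"
      using less_conj_part_iff[OF assms(1), of "i + 1" "conj_part mu (i + 1)"] assms(2) by simp
    then show False by simp
  qed
  then show ?thesis using assms frob_q_eq[of mu i] frob_q_eq[of mu j] by simp
qed

lemma frob_q_less_length:
  assumes "is_partition mu" "i < dnum mu"
  shows "frob_q mu i < length mu"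
proof -
  have "frob_q mu i < conj_part mu (i + 1)" using frob_q_eq[OF assms] by simp
  then have "0 < part mu (frob_q mu i)" using less_conj_part_iff[OF assms(1), of "i + 1"] by simp
  then show ?thesis using part_pos_iff[OF assms(1)] by simp
qed

section \<open>Partitions as pairs of decreasing coordinate lists\<close>

definition frob_ps :: "nat list \<Rightarrow> nat list" where
  "frob_ps mu = map (frob_p mu) [0..<dnum mu]"

definition frob_qs :: "nat list \<Rightarrow> nat list" where
  "frob_qs mu = map (frob_q mu) [0..<dnum mu]"

lemma sorted_frob_ps: "is_partition mu \<Longrightarrow> sorted_wrt (>) (frob_ps mu)"
  by (auto simp: frob_ps_def sorted_wrt_iff_nth_less frob_p_less)

lemma sorted_frob_qs: "is_partition mu \<Longrightarrow> sorted_wrt (>) (frob_qs mu)"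
  by (auto simp: frob_qs_def sorted_wrt_iff_nth_less frob_q_less)

lemma length_frob [simp]: "length (frob_ps mu) = dnum mu" "length (frob_qs mu) = dnum mu"
  by (simp_all add: frob_ps_def frob_qs_def)

lemma frob_qs_bound:
  assumes "is_partition mu" "length mu \<le> N"
  shows "set (frob_qs mu) \<subseteq> {..<N}"
  using assms frob_q_less_length[OF assms(1)] by (fastforce simp: frob_qs_def)

text \<open>For i \<ge> d and t < d, i - \<mu>_i is below q_t if the box (i, t) lies in the diagram
  and above it otherwise. So the two families are disjoint, and d + (N - d) = N values fill the
  range; both lists being increasing, equality of sets suffices.\<close>

lemma frob_qs_complement:
  assumes mu: "is_partition mu" and N: "length mu \<le> N"
  shows "filter (\<lambda>r. r \<notin> set (frob_qs mu)) [0..<N] = map (\<lambda>i. i - part mu i) [dnum mu..<N]"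
proof (rule strict_sorted_equal)
  let ?d = "dnum mu" and ?g = "\<lambda>i. i - part mu i"
  have le: "part mu i \<le> i" if "?d \<le> i" for i using less_dnum_iff[OF mu, of i] that by simp
  have mono: "?g i < ?g j" if "?d \<le> i" "i < j" for i j
    using le[OF that(1)] part_antimono[OF mu, of i j] that by linarith
  show sorted: "sorted_wrt (<) (map ?g [?d..<N])"
    by (auto simp: sorted_wrt_iff_nth_less mono)
  show "sorted_wrt (<) (filter (\<lambda>r. r \<notin> set (frob_qs mu)) [0..<N])"
    by (intro sorted_wrt_filter) simp
  have ne: "?g i \<noteq> frob_q mu t" if "?d \<le> i" "t < ?d" for i t
  proof (cases "i < conj_part mu (t + 1)")
    case True
    then have "t + 1 \<le> part mu i" using less_conj_part_iff[OF mu] by simp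
    with True show ?thesis using frob_q_eq[OF mu that(2)] le[OF that(1)] by simp
  next
    case False
    then have "part mu i < t + 1" using less_conj_part_iff[OF mu, of "t + 1" i] by simp
    with False show ?thesis using frob_q_eq[OF mu that(2)] by simp
  qed
  have sub: "set (map ?g [?d..<N]) \<subseteq> {..<N} - set (frob_qs mu)"
    using ne by (auto simp: frob_qs_def)
  moreover have "card ({..<N} - set (frob_qs mu)) = N - ?d"
    using decreasing_list_distinct[OF sorted_frob_qs[OF mu]] frob_qs_bound[OF mu N]
    by (simp add: card_Diff_subset distinct_card)
  moreover have "card (set (map ?g [?d..<N])) = N - ?d"
    using sorted by (simp add: distinct_card strict_sorted_iff del: set_map)
  ultimately have "set (map ?g [?d..<N]) = {..<N} - set (frob_qs mu)"
    by (intro card_subset_eq) auto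
  then show "set (filter (\<lambda>r. r \<notin> set (frob_qs mu)) [0..<N]) = set (map ?g [?d..<N])"
    by auto
qed

text \<open>The first d rows are read off from the p_i, the remaining ones from the complement of
  the q_i.\<close>

lemma frob_inj:
  assumes mu: "is_partition mu" and nu: "is_partition nu"
    and ps: "frob_ps mu = frob_ps nu" and qs: "frob_qs mu = frob_qs nu"
  shows "mu = nu"
proof (rule part_eq_imp_eq[OF mu nu])
  fix i
  \<comment> \<open>Bounds both lengths and exceeds the row i in question.\<close>
  define N where "N = Suc i + length mu + length nu"
  have d: "dnum mu = dnum nu" using ps by (metis length_frob(1))
  show "part mu i = part nu i"
  proof (cases "i < dnum mu")
    case True
    then have "frob_p mu i = frob_p nu i"
      using ps d by (auto simp: frob_ps_def)
    then show ?thesis using frob_p_eq[OF mu] frob_p_eq[OF nu] True d by simp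
  next
    case False
    have "map (\<lambda>i. i - part mu i) [dnum mu..<N] = map (\<lambda>i. i - part nu i) [dnum mu..<N]"
      using frob_qs_complement[OF mu, of N] frob_qs_complement[OF nu, of N] d qs by (simp add: N_def)
    then have "i - part mu i = i - part nu i"
      using False by (simp add: map_eq_conv N_def del: upt_Suc)
    moreover have "part mu i \<le> i" "part nu i \<le> i"
      using less_dnum_iff[OF mu, of i] less_dnum_iff[OF nu, of i] False d by auto
    ultimately show ?thesis by simp
  qed
qed

lemma ex_partition_of_antimono:
  fixes f :: "nat \<Rightarrow> nat"
  assumes f: "\<And>i. f (Suc i) \<le> f i" and N: "f N = 0"
  shows "\<exists>nu. is_partition nu \<and> part nu = f \<and> length nu \<le> N"
proof -
  define n where "n = (LEAST n. f n = 0)"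
  have anti: "f j \<le> f i" if "i \<le> j" for i j
    using that f by (rule lift_Suc_antimono_le[rotated])
  have n: "f n = 0" "n \<le> N" using N by (auto simp: n_def intro: LeastI Least_le)
  have pos: "0 < f i" if "i < n" for i using not_less_Least[of i "\<lambda>n. f n = 0"] that by (auto simp: n_def)
  define nu where "nu = map f [0..<n]"
  have "is_partition nu"
    using anti pos by (auto simp: is_partition_def nu_def sorted_wrt_iff_nth_less)
  moreover have "part nu = f"
    using anti[of n] n by (fastforce simp: part_def nu_def not_less)
  ultimately show ?thesis using n by (auto simp: nu_def)
qed

text \<open>The entries from t on are distinct, at least the t-th one, and below N. This keeps the
  subtraction in \<open>frob_surj\<close> from being truncated.\<close>

lemma increasing_list_nth_bound:
  assumes "sorted_wrt (<) rs" "set rs \<subseteq> {..<N}" "t < length rs"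
  shows "rs ! t + (length rs - t) \<le> (N :: nat)"
proof -
  have "rs ! t + k \<le> rs ! (t + k)" if "t + k < length rs" for k
    using that
  proof (induction k)
    case (Suc k)
    then have "rs ! (t + k) < rs ! (t + Suc k)"
      using assms(1) by (intro sorted_wrt_nth_less) auto
    with Suc show ?case by simp
  qed simp
  from this[of "length rs - Suc t"] assms(3)
  have "rs ! t + (length rs - Suc t) \<le> rs ! (length rs - 1)" by simp
  moreover have "rs ! (length rs - 1) < N"
    using assms(2,3) nth_mem[of "length rs - 1" rs] by fastforce
  ultimately show ?thesis using assms(3) by simp
qed

text \<open>Inverts the reading of \<open>frob_inj\<close>: the rows are rebuilt from
  \<open>ps\<close> and from the complement \<open>rs\<close> of \<open>qs\<close>.\<close>

lemma frob_surj:
  assumes ps: "sorted_wrt (>) ps" and qs: "sorted_wrt (>) qs" "set qs \<subseteq> {..<N}"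
    and len: "length ps = d" "length qs = d"
  shows "\<exists>nu. is_partition nu \<and> length nu \<le> N \<and> dnum nu = d \<and> frob_ps nu = ps \<and> frob_qs nu = qs"
proof -
  define rs where "rs = filter (\<lambda>r. r \<notin> set qs) [0..<N]"
  have setrs: "set rs = {..<N} - set qs" by (auto simp: rs_def)
  have rs: "sorted_wrt (<) rs" unfolding rs_def by (intro sorted_wrt_filter) simp
  have card_qs: "card (set qs) = d" using decreasing_list_distinct[OF qs(1)] len by (simp add: distinct_card)
  have dN: "d \<le> N" using card_mono[OF _ qs(2)] card_qs by simp
  have lenrs: "length rs = N - d"
  proof -
    have "length rs = card (set rs)" using rs by (simp add: distinct_card strict_sorted_iff)
    then show ?thesis using setrs qs(2) card_qs by (simp add: card_Diff_subset)
  qed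
  have rs_le: "rs ! (i - d) \<le> i" if "d \<le> i" "i < N" for i
  proof -
    have "set rs \<subseteq> {..<N}" by (simp add: setrs Diff_subset)
    moreover have "i - d < length rs" unfolding lenrs using that by simp
    ultimately have "rs ! (i - d) + (length rs - (i - d)) \<le> N"
      by (rule increasing_list_nth_bound[OF rs])
    then show ?thesis unfolding lenrs using that by linarith
  qed
  \<comment> \<open>Solves p_i = f i - i - 1 for i < d and rs_(i-d) = i - f i for d \<le> i < N. At
    the seam, f d \<le> d \<le> f (d - 1).\<close>
  define f where "f i = (if i < d then ps ! i + i + 1 else if i < N then i - rs ! (i - d) else 0)" for i
  have "f (Suc i) \<le> f i" for i
  proof -
    consider "Suc i < d" | "Suc i = d" | "d \<le> i" "Suc i < N" | "d \<le> i" "N \<le> Suc i" by linarith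
    then show ?thesis
    proof cases
      case 1
      then have "ps ! Suc i < ps ! i" using sorted_wrt_nth_less[OF ps, of i "Suc i"] len by simp
      with 1 show ?thesis by (simp add: f_def)
    next
      case 3
      then have "rs ! (i - d) < rs ! (Suc i - d)"
        using lenrs by (intro sorted_wrt_nth_less[OF rs]) auto
      with 3 show ?thesis by (simp add: f_def)
    qed (auto simp: f_def)
  qed
  moreover have "f N = 0" using dN by (simp add: f_def)
  ultimately obtain nu where nu: "is_partition nu" "part nu = f" "length nu \<le> N"
    using ex_partition_of_antimono by blast
  have "i < dnum nu \<longleftrightarrow> i < d" for i
    unfolding less_dnum_iff[OF nu(1)] nu(2) by (auto simp: f_def)
  then have d: "dnum nu = d" by (metis linorder_neqE_nat less_irrefl)
  have "frob_p nu i = ps ! i" if "i < d" for i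
    using frob_p_eq[OF nu(1), of i] that d by (simp add: nu(2) f_def)
  then have ps_eq: "frob_ps nu = ps"
    using len d by (intro nth_equalityI) (auto simp: frob_ps_def)
  have "map (\<lambda>i. i - part nu i) [d..<N] = rs"
    using lenrs rs_le[of "d + _"] by (intro nth_equalityI) (auto simp: nu(2) f_def)
  then have "filter (\<lambda>r. r \<notin> set (frob_qs nu)) [0..<N] = rs"
    using frob_qs_complement[OF nu(1,3)] d by simp
  then have "{..<N} - set (frob_qs nu) = {..<N} - set qs"
    using arg_cong[of _ _ set] setrs by fastforce
  then have "set (frob_qs nu) = set qs"
    using frob_qs_bound[OF nu(1,3)] qs(2) by blast
  then have "frob_qs nu = qs"
    by (rule decreasing_list_unique[OF sorted_frob_qs[OF nu(1)] qs(1)])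
  then show ?thesis using nu d ps_eq by blast
qed

text \<open>Rows that meet the diagonal are compared through p. A box of a lower row lies in a
  column t < d, and these columns are compared through q.\<close>

lemma subpart_if_frob_le:
  assumes mu: "is_partition mu" and nu: "is_partition nu" and d: "dnum nu = dnum mu"
    and p: "\<And>i. i < dnum mu \<Longrightarrow> frob_p nu i \<le> frob_p mu i"
    and q: "\<And>i. i < dnum mu \<Longrightarrow> frob_q nu i \<le> frob_q mu i"
  shows "subpart nu mu"
  unfolding subpart_iff[OF mu nu]
proof
  fix i
  show "part nu i \<le> part mu i"
  proof (cases "i < dnum mu")
    case True
    then show ?thesis using p frob_p_eq[OF mu True] frob_p_eq[OF nu, of i] d by simp
  next
    case False
    show ?thesis
    proof (cases "part nu i")
      case (Suc t)
      have "part nu i \<le> part nu (dnum nu)"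
        using part_antimono[OF nu] False d by simp
      also have "\<dots> \<le> dnum nu" using less_dnum_iff[OF nu, of "dnum nu"] by simp
      finally have t: "t < dnum mu" using Suc d by simp
      have "i < conj_part nu (t + 1)" using less_conj_part_iff[OF nu, of "t + 1" i] Suc by simp
      also have "\<dots> \<le> conj_part mu (t + 1)"
        using frob_q_eq[OF mu t] frob_q_eq[OF nu, of t] q[OF t] t d by simp
      finally show ?thesis using less_conj_part_iff[OF mu, of "t + 1" i] Suc by simp
    qed simp
  qed
qed

lemma finite_subparts: "finite {nu. is_partition nu \<and> subpart nu mu}"
proof (rule finite_subset)
  show "finite {nu. set nu \<subseteq> {..sum_list mu} \<and> length nu \<le> length mu}"
    by (rule finite_lists_length_le) simp
  show "{nu. is_partition nu \<and> subpart nu mu} \<subseteq> {nu. set nu \<subseteq> {..sum_list mu} \<and> length nu \<le> length mu}"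
  proof clarify
    fix nu assume "subpart nu mu"
    then have l: "length nu \<le> length mu" and le: "\<And>i. i < length nu \<Longrightarrow> nu ! i \<le> mu ! i"
      by (auto simp: subpart_def)
    have "x \<le> sum_list mu" if "x \<in> set nu" for x
    proof -
      from that obtain i where i: "i < length nu" "x = nu ! i" by (auto simp: in_set_conv_nth)
      then have "x \<le> mu ! i" using le by simp
      also have "mu ! i \<le> sum_list mu" using i l by (intro member_le_sum_list) auto
      finally show ?thesis .
    qed
    with l show "set nu \<subseteq> {..sum_list mu} \<and> length nu \<le> length mu" by auto
  qed
qed

lemma sum_list_eq_sum_part:
  assumes "length mu \<le> N"
  shows "sum_list mu = (\<Sum>i<N. part mu i)"
proof -
  have "(\<Sum>i<N. part mu i) = (\<Sum>i<length mu. part mu i)"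
    by (rule sum.mono_neutral_right) (use assms in \<open>auto simp: part_def\<close>)
  then show ?thesis by (simp add: sum_list_sum_nth part_def atLeast0LessThan)
qed

lemma subpart_sum_list:
  assumes mu: "is_partition mu" and nu: "is_partition nu" and sub: "subpart nu mu"
  shows "sum_list nu \<le> sum_list mu" and "sum_list nu = sum_list mu \<Longrightarrow> nu = mu"
proof -
  have l: "length nu \<le> length mu" using sub by (simp add: subpart_def)
  note s = sum_list_eq_sum_part[OF l] sum_list_eq_sum_part[OF order.refl, of mu]
  have le: "part nu i \<le> part mu i" for i using sub subpart_iff[OF mu nu] by simp
  then show "sum_list nu \<le> sum_list mu" unfolding s by (intro sum_mono)
  assume eq: "sum_list nu = sum_list mu"
  show "nu = mu"
  proof (rule part_eq_imp_eq[OF nu mu])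
    fix i
    show "part nu i = part mu i"
    proof (cases "i < length mu")
      case True
      show ?thesis
      proof (rule ccontr)
        assume "\<not> ?thesis"
        with le[of i] have "part nu i < part mu i" by simp
        then have "(\<Sum>i<length mu. part nu i) < (\<Sum>i<length mu. part mu i)"
          using True le by (intro sum_strict_mono_ex1) auto
        with eq s show False by simp
      qed
    next
      case False
      then show ?thesis using l by (simp add: part_def)
    qed
  qed
qed

section \<open>Expansion of multiparameter Schur functions\<close>

text \<open>A zero part added at position N contributes the row of index -N - 1, which is the last
  unit vector, so the determinant is independent of the size.\<close>

lemma schur_eq_det_jt_row:
  assumes "length mu \<le> N"
  shows "schur a mu xs = det (mat N N (\<lambda>(i, j). jt_row a xs (int (part mu i) - int i - 1) j))"
  using assms
proof (induction N rule: dec_induct)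
  case base
  show ?case unfolding schur_def
    by (rule arg_cong[of _ _ det], rule eq_matI) (auto simp: jt_row_def part_def)
next
  case (step N)
  let ?A = "mat (Suc N) (Suc N) (\<lambda>(i, j). jt_row a xs (int (part mu i) - int i - 1) j)"
  have "det ?A = (\<Sum>j<Suc N. ?A $$ (N, j) * cofactor ?A N j)"
    by (rule laplace_expansion_row) auto
  also have "\<dots> = (\<Sum>j<Suc N. if j = N then cofactor ?A N j else 0)"
    using step.hyps by (intro sum.cong) (auto simp: part_def jt_row_neg)
  also have "\<dots> = det (mat_delete ?A N N)" by (simp add: cofactor_def)
  also have "mat_delete ?A N N = mat N N (\<lambda>(i, j). jt_row a xs (int (part mu i) - int i - 1) j)"
    by (rule eq_matI) (auto simp: mat_delete_def)
  finally show ?case using step.IH by simp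
qed

text \<open>The Jacobi-Trudi matrix factors as E times \<open>neg_mat\<close>, which has determinant
  1. The first d rows of E consist of signed hooks, the others are unit vectors whose positions are
  the complement of the q_i; \<open>det_unit_rows\<close> reduces E to a d by d minor.\<close>

lemma giambelli:
  assumes mu: "is_partition mu" and N: "length mu \<le> N"
  shows "schur a mu xs = det (mat (dnum mu) (dnum mu) (\<lambda>(i, t). hook a xs N (frob_p mu i) (frob_q mu t)))"
proof -
  let ?d = "dnum mu" and ?qs = "frob_qs mu"
  let ?rs = "filter (\<lambda>r. r \<notin> set ?qs) [0..<N]"
  define E where "E = mat N N (\<lambda>(i, j). if i < length ?qs then (-1) ^ j * hook a xs N (frob_p mu i) j
           else if j = ?rs ! (i - length ?qs) then 1 else 0)"
  \<comment> \<open>Row i \<ge> d has index -r - 1 with r = i - \<mu>_i, hence is itself a row of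
    \<open>neg_mat\<close>.\<close>
  have rs: "?rs ! (i - ?d) = i - part mu i" if "?d \<le> i" "i < N" for i
  proof -
    have "[?d..<N] ! (i - ?d) = i" using that by (subst nth_upt) auto
    then show ?thesis unfolding frob_qs_complement[OF mu N] using that by simp
  qed
  have E: "E \<in> carrier_mat N N" by (simp add: E_def)
  have "mat N N (\<lambda>(i, j). jt_row a xs (int (part mu i) - int i - 1) j) = E * neg_mat a xs N"
  proof (rule eq_matI)
    fix i j assume "i < dim_row (E * neg_mat a xs N)" "j < dim_col (E * neg_mat a xs N)"
    then have ij: "i < N" "j < N" using E neg_mat_carrier[of a xs N] by auto
    show "mat N N (\<lambda>(i, j). jt_row a xs (int (part mu i) - int i - 1) j) $$ (i, j) = (E * neg_mat a xs N) $$ (i, j)"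
      unfolding sum_mat_mult_index[OF E neg_mat_carrier ij]
    proof (cases "i < ?d")
      case True
      then have "int (part mu i) - int i - 1 = int (frob_p mu i)" using frob_p_eq[OF mu] by simp
      then show "mat N N (\<lambda>(i, j). jt_row a xs (int (part mu i) - int i - 1) j) $$ (i, j)
          = (\<Sum>l<N. E $$ (i, l) * neg_mat a xs N $$ (l, j))"
        using True ij jt_row_eq_hook[OF ij(2), of a xs "frob_p mu i"] by (simp add: E_def neg_mat_def)
    next
      case False
      let ?r = "i - part mu i"
      have r: "?r < N" "int (part mu i) - int i - 1 = - int ?r - 1"
        using less_dnum_iff[OF mu, of i] False ij by auto
      have "(\<Sum>l<N. E $$ (i, l) * neg_mat a xs N $$ (l, j)) = (\<Sum>l<N. if l = ?r then jt_row a xs (- int l - 1) j else 0)"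
        using False ij rs by (intro sum.cong) (auto simp: E_def neg_mat_def)
      also have "\<dots> = jt_row a xs (- int ?r - 1) j" using r(1) by (simp only: sum.delta finite_lessThan lessThan_iff if_True)
      finally show "mat N N (\<lambda>(i, j). jt_row a xs (int (part mu i) - int i - 1) j) $$ (i, j)
          = (\<Sum>l<N. E $$ (i, l) * neg_mat a xs N $$ (l, j))"
        unfolding r(2)[symmetric] using ij by simp
    qed
  qed (use E neg_mat_carrier[of a xs N] in auto)
  then have "schur a mu xs = det E"
    by (simp add: schur_eq_det_jt_row[OF N] det_mult[OF E neg_mat_carrier] det_neg_mat)
  also have "\<dots> = det (mat ?d ?d (\<lambda>(i, t). hook a xs N (frob_p mu i) (?qs ! t)))"
    unfolding E_def det_unit_rows[OF sorted_frob_qs[OF mu] frob_qs_bound[OF mu N]] by simp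
  also have "\<dots> = det (mat ?d ?d (\<lambda>(i, t). hook a xs N (frob_p mu i) (frob_q mu t)))"
    by (rule arg_cong[of _ _ det], rule eq_matI) (auto simp: frob_qs_def)
  finally show ?thesis .
qed

section \<open>Triangularity of the coefficients and the expansion\<close>

lemma cpp_eq_0: "p < p' \<Longrightarrow> cpp a b p p' = 0"
  by (simp add: cpp_eq_newton_coeff)

lemma cpp_self: "cpp a b p p = 1"
  by (simp add: cpp_eq_newton_coeff)

lemma frob_coeff_nonzero_imp_subpart:
  assumes mu: "is_partition mu" and nu: "is_partition nu" and d: "dnum nu = dnum mu"
    and nz: "frob_coeff a b mu nu \<noteq> 0"
  shows "subpart nu mu"
proof (rule subpart_if_frob_le[OF mu nu d])
  have anti: "frob_p nu j \<le> frob_p nu i" "frob_q nu j \<le> frob_q nu i"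
    if "is_partition nu" "i \<le> j" "j < dnum nu" for i j nu
    using that frob_p_less[of nu i j] frob_q_less[of nu i j] by (cases "i = j"; simp)+
  fix i assume i: "i < dnum mu"
  show "frob_p nu i \<le> frob_p mu i"
    by (rule det_triangular_nonzero_imp_le[of "cpp a b" "dnum mu" "frob_p mu" "frob_p nu"])
       (use nz i d anti mu nu in \<open>auto simp: cpp_eq_0 frob_coeff_def\<close>)
  show "frob_q nu i \<le> frob_q mu i"
    by (rule det_triangular_nonzero_imp_le[of "cpp (dual_seq a) (dual_seq b)" "dnum mu" "frob_q mu" "frob_q nu"])
       (use nz i d anti mu nu in \<open>auto simp: cpp_eq_0 frob_coeff_def\<close>)
qed

lemma frob_coeff_self:
  assumes "is_partition mu"
  shows "frob_coeff a b mu mu = 1"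
  unfolding frob_coeff_def
  using det_unitriangular[of "cpp a b" "dnum mu" "frob_p mu"]
    det_unitriangular[of "cpp (dual_seq a) (dual_seq b)" "dnum mu" "frob_q mu"]
    frob_p_less[OF assms] frob_q_less[OF assms]
  by (simp add: cpp_eq_0 cpp_self)

text \<open>Converts the two index lists of a double Cauchy-Binet sum into one partition.\<close>

lemma bij_betw_frob:
  "bij_betw (\<lambda>nu. (frob_ps nu, frob_qs nu))
     {nu. is_partition nu \<and> length nu \<le> N \<and> dnum nu = d \<and> set (frob_ps nu) \<subseteq> {..<K}}
     (decreasing_lists K d \<times> decreasing_lists N d)"
  unfolding bij_betw_def
proof
  let ?X = "{nu. is_partition nu \<and> length nu \<le> N \<and> dnum nu = d \<and> set (frob_ps nu) \<subseteq> {..<K}}"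
  show "inj_on (\<lambda>nu. (frob_ps nu, frob_qs nu)) ?X"
    by (rule inj_onI) (auto intro: frob_inj)
  show "(\<lambda>nu. (frob_ps nu, frob_qs nu)) ` ?X = decreasing_lists K d \<times> decreasing_lists N d"
  proof (intro equalityI subsetI)
    fix z assume "z \<in> (\<lambda>nu. (frob_ps nu, frob_qs nu)) ` ?X"
    then show "z \<in> decreasing_lists K d \<times> decreasing_lists N d"
      using frob_qs_bound sorted_frob_ps sorted_frob_qs by (auto simp: decreasing_lists_def)
  next
    fix z assume "z \<in> decreasing_lists K d \<times> decreasing_lists N d"
    then obtain ps qs where z: "z = (ps, qs)" and *: "length ps = d" "sorted_wrt (>) ps" "set ps \<subseteq> {..<K}"
      "length qs = d" "sorted_wrt (>) qs" "set qs \<subseteq> {..<N}"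
      by (auto simp: decreasing_lists_def)
    then obtain nu where "is_partition nu" "length nu \<le> N" "dnum nu = d" "frob_ps nu = ps" "frob_qs nu = qs"
      using frob_surj[of ps qs N d] by blast
    then show "z \<in> (\<lambda>nu. (frob_ps nu, frob_qs nu)) ` ?X"
      unfolding z using *(3) by (intro image_eqI[of _ _ nu]) auto
  qed
qed

text \<open>By \<open>hook_transition\<close> the Giambelli matrix for a is a triple product with
  the hooks of b in the middle. Cauchy-Binet is applied twice, and by Giambelli again each middle
  minor is a Schur function for b.\<close>

lemma schur_expansion:
  assumes mu: "is_partition mu"
  shows "schur a mu xs = (\<Sum>nu | is_partition nu \<and> subpart nu mu \<and> dnum nu = dnum mu.
    frob_coeff a b mu nu * schur b nu xs)"
proof -
  define d where "d = dnum mu"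
  define N where "N = length mu"
  \<comment> \<open>Exceeds every p_i of \<mu> and of every partition contained in \<mu>.\<close>
  define K where "K = Suc (part mu 0)"
  let ?C = "\<lambda>i k. cpp a b (frob_p mu i) k"
  let ?C' = "\<lambda>j k. cpp (dual_seq a) (dual_seq b) (frob_q mu j) k"
  let ?h = "hook b xs N"
  let ?X = "{nu. is_partition nu \<and> length nu \<le> N \<and> dnum nu = d \<and> set (frob_ps nu) \<subseteq> {..<K}}"
  let ?Y = "{nu. is_partition nu \<and> subpart nu mu \<and> dnum nu = dnum mu}"
  have p_lt: "frob_p mu i < K" if "i < d" for i
    using frob_p_eq[OF mu, of i] part_antimono[OF mu, of 0 i] that by (simp add: K_def d_def)
  have q_lt: "frob_q mu i < N" if "i < d" for i
    using frob_q_less_length[OF mu, of i] that by (simp add: N_def d_def)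
  define g where "g P Q = det (mat d d (\<lambda>(i, t). ?C i (P ! t))) * det (mat d d (\<lambda>(s, t). ?h (P ! s) (Q ! t)))
     * det (mat d d (\<lambda>(t, j). ?C' j (Q ! t)))" for P Q
  have "schur a mu xs = det (mat d d (\<lambda>(i, j). hook a xs N (frob_p mu i) (frob_q mu j)))"
    unfolding d_def by (rule giambelli[OF mu]) (simp add: N_def)
  also have "mat d d (\<lambda>(i, j). hook a xs N (frob_p mu i) (frob_q mu j))
      = mat d d (\<lambda>(i, j). \<Sum>p<K. ?C i p * (\<Sum>q<N. ?h p q * ?C' j q))"
    by (rule eq_matI)
       (auto simp: hook_transition[OF p_lt q_lt, of _ _ a xs b] sum_distrib_left mult.assoc)
  also have "det \<dots> = (\<Sum>P\<in>decreasing_lists K d. det (mat d d (\<lambda>(i, t). ?C i (P ! t)))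
      * det (mat d d (\<lambda>(t, j). \<Sum>q<N. ?h (P ! t) q * ?C' j q)))"
    by (rule cauchy_binet)
  also have "\<dots> = (\<Sum>P\<in>decreasing_lists K d. \<Sum>Q\<in>decreasing_lists N d. g P Q)"
    by (rule sum.cong[OF refl]) (simp only: cauchy_binet g_def sum_distrib_left mult.assoc)
  also have "\<dots> = (\<Sum>(P, Q)\<in>decreasing_lists K d \<times> decreasing_lists N d. g P Q)"
    by (rule sum.cartesian_product)
  also have "\<dots> = (\<Sum>nu\<in>?X. g (frob_ps nu) (frob_qs nu))"
    by (subst sum.reindex_bij_betw[OF bij_betw_frob, symmetric]) simp
  also have "\<dots> = (\<Sum>nu\<in>?X. frob_coeff a b mu nu * schur b nu xs)"
  proof (rule sum.cong[OF refl])
    fix nu assume "nu \<in> ?X"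
    then have nu: "is_partition nu" "length nu \<le> N" "dnum nu = d" by auto
    have nth: "frob_ps nu ! t = frob_p nu t" "frob_qs nu ! t = frob_q nu t" if "t < d" for t
      using that nu(3) by (simp_all add: frob_ps_def frob_qs_def)
    \<comment> \<open>The dual coefficients stand on the right of the product, so their minor is the
      transpose of the one in \<open>frob_coeff\<close>.\<close>
    have "det (mat d d (\<lambda>(t, j). ?C' j (frob_qs nu ! t)))
        = det (transpose_mat (mat d d (\<lambda>(j, t). ?C' j (frob_q nu t))))"
      by (rule arg_cong[of _ _ det], rule eq_matI) (auto simp: nth)
    also have "\<dots> = det (mat d d (\<lambda>(j, t). ?C' j (frob_q nu t)))"
      by (rule det_transpose[of _ d]) simp
    finally have q: "det (mat d d (\<lambda>(t, j). ?C' j (frob_qs nu ! t))) = \<dots>" .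
    have p: "mat d d (\<lambda>(i, t). ?C i (frob_ps nu ! t)) = mat d d (\<lambda>(i, t). ?C i (frob_p nu t))"
      by (rule eq_matI) (auto simp: nth)
    have "mat d d (\<lambda>(s, t). ?h (frob_ps nu ! s) (frob_qs nu ! t)) = mat d d (\<lambda>(s, t). ?h (frob_p nu s) (frob_q nu t))"
      by (rule eq_matI) (auto simp: nth)
    then have s: "det (mat d d (\<lambda>(s, t). ?h (frob_ps nu ! s) (frob_qs nu ! t))) = schur b nu xs"
      using giambelli[OF nu(1,2), of b xs] nu(3) by simp
    show "g (frob_ps nu) (frob_qs nu) = frob_coeff a b mu nu * schur b nu xs"
      unfolding g_def q p s frob_coeff_def d_def[symmetric] by (simp add: mult_ac)
  qed
  also have "\<dots> = (\<Sum>nu\<in>?Y. frob_coeff a b mu nu * schur b nu xs)"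
  proof (rule sum.mono_neutral_right)
    show "finite ?X"
      using bij_betw_finite[OF bij_betw_frob] finite_decreasing_lists by blast
    show "?Y \<subseteq> ?X"
    proof
      fix nu assume "nu \<in> ?Y"
      then have nu: "is_partition nu" "subpart nu mu" "dnum nu = dnum mu" by auto
      have "frob_p nu i < K" if "i < dnum nu" for i
        using frob_p_eq[OF nu(1) that] part_antimono[OF nu(1), of 0 i] nu(2) subpart_iff[OF mu nu(1)]
          le_trans[of "part nu i" "part nu 0" "part mu 0"]
        by (simp add: K_def)
      then show "nu \<in> ?X"
        using nu by (auto simp: frob_ps_def N_def d_def subpart_def)
    qed
    show "\<forall>nu\<in>?X - ?Y. frob_coeff a b mu nu * schur b nu xs = 0"
      using frob_coeff_nonzero_imp_subpart[OF mu] by (auto simp: d_def)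
  qed
  finally show ?thesis .
qed

section \<open>Linear independence\<close>

lemma hA_zero: "hA (\<lambda>_. 0) k xs = (if k < 0 then 0 else hcomp (nat k) xs)"
proof -
  have e: "ecomp m (map (\<lambda>_. 0) ys) = (if m = 0 then 1 else 0)" for m and ys :: "nat list"
    by (induction ys arbitrary: m) auto
  have h: "hcomp 0 xs = 1" by (induction xs) auto
  show ?thesis
  proof (cases "0 < k")
    case True
    have "(\<Sum>i=1..nat k. (-1) ^ (nat k - i) * ecomp (nat k - i) (seg (\<lambda>_. 0) (nat k - 1)) * hcomp i xs)
        = (\<Sum>i=1..nat k. if i = nat k then hcomp i xs else 0)"
      unfolding seg_def e by (rule sum.cong) auto
    then show ?thesis using True by (simp add: hA_def)
  qed (auto simp: hA_def h)
qed

text \<open>Coefficient of t^m in 1/(1 - x_l t) = E(-t) H(t), where E omits the variable x_l; with n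
  - 1 variables left, terms of degree r \<ge> n vanish.\<close>

lemma power_eq_sum_ecomp_hcomp:
  assumes l: "l < length xs"
  shows "xs ! l ^ m = (\<Sum>r<length xs. ecomp r (map uminus (take l xs @ drop (Suc l) xs)) *
    (if r \<le> m then hcomp (m - r) xs else 0))"
proof -
  let ?n = "length xs" and ?ys = "map uminus (take l xs @ drop (Suc l) xs)"
  have "xs = take l xs @ xs ! l # drop (Suc l) xs" by (rule id_take_nth_drop[OF l])
  then have "ecomp_fps (map uminus xs)
      = ecomp_fps (map uminus (take l xs @ xs ! l # drop (Suc l) xs))" by simp
  also have "\<dots> = ecomp_fps (map uminus [xs ! l]) * ecomp_fps ?ys"
    by (simp only: map_append list.map ecomp_fps_append ecomp_fps_Cons ecomp_fps_Nil mult_1_left mult_1_right mult_ac)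
  finally have "ecomp_fps (map uminus [xs ! l]) * (ecomp_fps ?ys * hcomp_fps xs) = 1"
    using hcomp_fps_mult[of xs] by (simp only: mult.assoc)
  moreover have "ecomp_fps (map uminus [xs ! l]) \<noteq> 0"
    using hcomp_fps_mult[of "[xs ! l]"] by auto
  ultimately have eq: "ecomp_fps ?ys * hcomp_fps xs = hcomp_fps [xs ! l]"
    using hcomp_fps_mult[of "[xs ! l]"] by (metis mult_cancel_left)
  have e0: "ecomp r ?ys = 0" if "?n \<le> r" for r
    by (rule ecomp_eq_0) (use l that in auto)
  have "hcomp m [xs ! l] = (\<Sum>j\<le>m. if j = m then xs ! l ^ j else 0)"
    unfolding hcomp.simps by (rule sum.cong) auto
  then have "xs ! l ^ m = hcomp m [xs ! l]" by (simp del: hcomp.simps)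
  also have "\<dots> = fps_nth (ecomp_fps ?ys * hcomp_fps xs) m"
    unfolding eq by (simp add: hcomp_fps_def)
  also have "\<dots> = (\<Sum>r\<le>m. ecomp r ?ys * (if r \<le> m then hcomp (m - r) xs else 0))"
    by (simp add: fps_mult_nth ecomp_fps_def hcomp_fps_def atLeast0AtMost)
  also have "\<dots> = (\<Sum>r\<in>{..m} \<inter> {..<?n}. ecomp r ?ys * (if r \<le> m then hcomp (m - r) xs else 0))"
    by (rule sum.mono_neutral_right) (auto simp: e0 not_less simp del: map_append)
  also have "\<dots> = (\<Sum>r<?n. ecomp r ?ys * (if r \<le> m then hcomp (m - r) xs else 0))"
    by (rule sum.mono_neutral_left) auto
  finally show ?thesis .
qed

text \<open>The alternant matrix is the Jacobi-Trudi matrix times a matrix of elementary symmetric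
  functions. The latter depends on \<open>xs\<close> only, so a linear relation between Schur
  functions passes to alternants.\<close>

lemma schur_zero_alternant:
  assumes "length nu \<le> length xs"
  defines "n \<equiv> length xs"
  shows "det (mat n n (\<lambda>(i, l). xs ! l ^ (part nu i + (n - Suc i)))) = schur (\<lambda>_. 0) nu xs *
    det (mat n n (\<lambda>(j, l). ecomp (n - Suc j) (map uminus (take l xs @ drop (Suc l) xs))))"
proof -
  let ?A = "mat n n (\<lambda>(i, j). jt_row (\<lambda>_. 0) xs (int (part nu i) - int i - 1) j)"
  let ?B = "mat n n (\<lambda>(j, l). ecomp (n - Suc j) (map uminus (take l xs @ drop (Suc l) xs)))"
  have A: "?A \<in> carrier_mat n n" and B: "?B \<in> carrier_mat n n" by auto
  have "mat n n (\<lambda>(i, l). xs ! l ^ (part nu i + (n - Suc i))) = ?A * ?B"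
  proof (rule eq_matI)
    fix i l assume "i < dim_row (?A * ?B)" "l < dim_col (?A * ?B)"
    then have il: "i < n" "l < n" by auto
    let ?m = "part nu i + (n - Suc i)"
    let ?e = "\<lambda>r. ecomp r (map uminus (take l xs @ drop (Suc l) xs))"
    have row: "jt_row (\<lambda>_. 0) xs (int (part nu i) - int i - 1) (n - Suc r) = (if r \<le> ?m then hcomp (?m - r) xs else 0)"
      if "r < n" for r
    proof -
      have "int (part nu i) - int i - 1 + 1 + int (n - Suc r) = int ?m - int r"
        using il that by (simp add: of_nat_diff)
      moreover have "nat (int ?m - int r) = ?m - r" by (simp add: nat_diff_distrib')
      moreover have "shift k (\<lambda>_. 0) = (\<lambda>_. 0)" for k by (simp add: shift_def)
      ultimately show ?thesis unfolding jt_row_def by (simp only: hA_zero) auto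
    qed
    have "(?A * ?B) $$ (i, l) = (\<Sum>j<n. jt_row (\<lambda>_. 0) xs (int (part nu i) - int i - 1) j * ?e (n - Suc j))"
      unfolding sum_mat_mult_index[OF A B il] using il by simp
    \<comment> \<open>Reversing the columns makes the summation index the degree of e.\<close>
    also have "\<dots> = (\<Sum>r<n. jt_row (\<lambda>_. 0) xs (int (part nu i) - int i - 1) (n - Suc r) * ?e (n - Suc (n - Suc r)))"
      by (rule sum.nat_diff_reindex[symmetric])
    also have "\<dots> = (\<Sum>r<n. ?e r * (if r \<le> ?m then hcomp (?m - r) xs else 0))"
      by (rule sum.cong) (auto simp: row)
    also have "\<dots> = xs ! l ^ ?m"
      unfolding n_def by (rule power_eq_sum_ecomp_hcomp[symmetric]) (use il in \<open>simp add: n_def\<close>)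
    finally show "mat n n (\<lambda>(i, l). xs ! l ^ (part nu i + (n - Suc i))) $$ (i, l) = (?A * ?B) $$ (i, l)"
      using il by simp
  qed auto
  then show ?thesis
    using det_mult[OF A B] schur_eq_det_jt_row[of nu n "\<lambda>_. 0" xs] assms by simp
qed

section \<open>Separating monomials and linear independence\<close>

lemma digits_unique:
  fixes u v :: "nat \<Rightarrow> nat"
  assumes "(\<Sum>l<n. B ^ l * u l) = (\<Sum>l<n. B ^ l * v l)"
    and "\<And>l. l < n \<Longrightarrow> u l < B" "\<And>l. l < n \<Longrightarrow> v l < B" "l < n"
  shows "u l = v l"
  using assms
proof (induction n arbitrary: u v l)
  case (Suc n)
  have split: "(\<Sum>l<Suc n. B ^ l * w l) = w 0 + B * (\<Sum>l<n. B ^ l * w (Suc l))" for w :: "nat \<Rightarrow> nat"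
    by (subst sum.lessThan_Suc_shift) (simp add: sum_distrib_left mult.assoc)
  have eq: "u 0 + B * (\<Sum>l<n. B ^ l * u (Suc l)) = v 0 + B * (\<Sum>l<n. B ^ l * v (Suc l))"
    using Suc.prems(1) by (simp only: split)
  have lt: "u 0 < B" "v 0 < B" using Suc.prems by auto
  have 0: "u 0 = v 0" using arg_cong[OF eq, of "\<lambda>x. x mod B"] lt by simp
  with eq lt have "(\<Sum>l<n. B ^ l * u (Suc l)) = (\<Sum>l<n. B ^ l * v (Suc l))" by simp
  from Suc.IH[OF this] Suc.prems have "u (Suc l) = v (Suc l)" if "l < n" for l using that by simp
  with 0 Suc.prems show ?case by (cases l) auto
qed simp

text \<open>Both sequences decrease strictly, so p is increasing, hence the identity.\<close>

lemma permutation_between_decreasing: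
  fixes K K' :: "nat \<Rightarrow> nat"
  assumes p: "p permutes {0..<n}" and eq: "\<And>l. l < n \<Longrightarrow> K (p l) = K' l"
    and K: "\<And>i j. i < j \<Longrightarrow> j < n \<Longrightarrow> K j < K i" and K': "\<And>i j. i < j \<Longrightarrow> j < n \<Longrightarrow> K' j < K' i"
  shows "p = id"
proof -
  have lt: "p l < n" if "l < n" for l using permutes_in_image[OF p, of l] that by auto
  have "p i < p j" if "i < j" "j < n" for i j
  proof (rule ccontr)
    assume "\<not> ?thesis"
    then consider "p j < p i" | "p i = p j" by linarith
    then have "K (p i) \<le> K (p j)" using K[of "p j" "p i"] lt[of i] that by cases auto
    with K'[OF that] eq that show False by simp
  qed
  then have "sorted_wrt (<) (map p [0..<n])" by (auto simp: sorted_wrt_iff_nth_less)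
  then have "map p [0..<n] = [0..<n]"
    using permutes_image[OF p] by (intro strict_sorted_equal) auto
  then have "p i = i" if "i < n" for i
    using that by (metis add_0 diff_zero length_upt nth_map nth_upt)
  then show ?thesis using permutes_not_in[OF p] by (fastforce simp: fun_eq_iff)
qed

text \<open>Evaluating at the points \<open>x\<^sub>l = T ^ (B ^ l)\<close> turns the exponents of the alternants into
  expansions in base \<open>B\<close>, so distinct monomials stay distinct as powers of \<open>T\<close>.\<close>

lemma schur_zero_lin_indep:
  assumes fin: "finite F" and part: "\<And>nu. nu \<in> F \<Longrightarrow> is_partition nu"
    and zero: "\<And>xs. (\<Sum>nu\<in>F. c nu * schur (\<lambda>_. 0) nu xs) = 0" and nu0: "nu0 \<in> F"
  shows "c nu0 = 0"
proof -
  define n where "n = (\<Sum>nu\<in>F. length nu)"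
  define K where "K nu i = part nu i + (n - Suc i)" for nu i
  \<comment> \<open>Larger than every exponent \<open>K nu i\<close>, so that these are digits in
    base B.\<close>
  define B where "B = Suc (n + (\<Sum>nu\<in>F. sum_list nu))"
  have n: "length nu \<le> n" if "nu \<in> F" for nu
    unfolding n_def by (rule member_le_sum) (use that fin in auto)
  have KB: "K nu i < B" if "nu \<in> F" for nu i
  proof -
    have "part nu i \<le> sum_list nu" by (auto simp: part_def intro: member_le_sum_list)
    also have "\<dots> \<le> (\<Sum>nu\<in>F. sum_list nu)"
      by (rule member_le_sum) (use that fin in auto)
    finally show ?thesis by (simp add: K_def B_def)
  qed
  have Kdec: "K nu j < K nu i" if "nu \<in> F" "i < j" "j < n" for nu i j
    using part_antimono[OF part[OF that(1)], of i j] that by (simp add: K_def)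
  let ?P = "{p. p permutes {0..<n}}"
  define ex where "ex nu p = (\<Sum>l<n. B ^ l * K nu (p l))" for nu p
  define Q :: "complex poly" where "Q = (\<Sum>nu\<in>F. \<Sum>p\<in>?P. monom (c nu * signof p) (ex nu p))"
  have finP: "finite ?P" by (rule finite_permutations) simp
  have "poly Q T = 0" for T
  proof -
    let ?xs = "map (\<lambda>l. T ^ (B ^ l)) [0..<n]"
    let ?D = "\<lambda>nu. det (mat n n (\<lambda>(i, l). ?xs ! l ^ K nu i))"
    obtain e where e: "?D nu = schur (\<lambda>_. 0) nu ?xs * e" if "nu \<in> F" for nu
      using schur_zero_alternant[of _ ?xs] n by (auto simp: K_def)
    have "poly Q T = (\<Sum>nu\<in>F. c nu * (\<Sum>p\<in>?P. signof p * T ^ ex nu p))"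
      by (simp add: Q_def poly_sum poly_monom sum_distrib_left mult.assoc)
    also have "\<dots> = (\<Sum>nu\<in>F. c nu * ?D nu)"
    proof (rule sum.cong[OF refl])
      fix nu
      have "?D nu = (\<Sum>p\<in>?P. signof p * (\<Prod>l<n. mat n n (\<lambda>(i, l). ?xs ! l ^ K nu i) $$ (p l, l)))"
        by (rule det_col) simp
      also have "\<dots> = (\<Sum>p\<in>?P. signof p * T ^ ex nu p)"
      proof (rule sum.cong[OF refl])
        fix p assume "p \<in> ?P"
        then have "p l < n" if "l < n" for l using permutes_in_image[of p "{0..<n}" l] that by auto
        then have "(\<Prod>l<n. mat n n (\<lambda>(i, l). ?xs ! l ^ K nu i) $$ (p l, l)) = (\<Prod>l<n. T ^ (B ^ l * K nu (p l)))"
          by (intro prod.cong) (auto simp: power_mult)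
        then show "signof p * (\<Prod>l<n. mat n n (\<lambda>(i, l). ?xs ! l ^ K nu i) $$ (p l, l)) = signof p * T ^ ex nu p"
          by (simp add: ex_def power_sum)
      qed
      finally show "c nu * (\<Sum>p\<in>?P. signof p * T ^ ex nu p) = c nu * ?D nu" by simp
    qed
    also have "\<dots> = (\<Sum>nu\<in>F. c nu * schur (\<lambda>_. 0) nu ?xs) * e"
      by (simp add: e sum_distrib_right mult.assoc)
    finally show ?thesis by (simp add: zero)
  qed
  then have Q0: "Q = 0" using poly_all_0_iff_0[of Q] by blast
  \<comment> \<open>The exponent for \<open>nu0\<close> and the identity arises once only: the
    digits force K nu (p l) = K nu0 l, both sequences decrease, so p is the identity and the parts
    agree.\<close>
  have uniq: "nu = nu0 \<and> p = id" if "nu \<in> F" "p \<in> ?P" "ex nu p = ex nu0 id" for nu p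
  proof -
    have p: "p permutes {0..<n}" using that by simp
    have K: "K nu (p l) = K nu0 l" if "l < n" for l
      using \<open>ex nu p = ex nu0 id\<close> KB[OF \<open>nu \<in> F\<close>] KB[OF nu0] that
      by (intro digits_unique[where u = "\<lambda>l. K nu (p l)" and v = "K nu0" and n = n and B = B]) (auto simp: ex_def)
    have id: "p = id"
      by (rule permutation_between_decreasing[where K = "K nu" and K' = "K nu0", OF p K Kdec[OF \<open>nu \<in> F\<close>] Kdec[OF nu0]])
    have "part nu i = part nu0 i" for i
    proof (cases "i < n")
      case True
      then show ?thesis using K[of i] id by (simp add: K_def)
    next
      case False
      then show ?thesis using n[OF \<open>nu \<in> F\<close>] n[OF nu0] by (simp add: part_def)
    qed
    then show ?thesis using id part_eq_imp_eq part nu0 \<open>nu \<in> F\<close> by blast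
  qed
  have "coeff Q (ex nu0 id) = (\<Sum>nu\<in>F. \<Sum>p\<in>?P. if nu = nu0 \<and> p = id then c nu * signof p else 0)"
    unfolding Q_def coeff_sum coeff_monom using uniq by (intro sum.cong refl) auto
  also have "\<dots> = (\<Sum>nu\<in>F. if nu = nu0 then c nu else 0)"
  proof (rule sum.cong[OF refl])
    fix nu
    have "(\<Sum>p\<in>?P. if nu = nu0 \<and> p = id then c nu * signof p else 0)
      = (\<Sum>p\<in>?P. if p = id then (if nu = nu0 then c nu else 0) else 0)"
      by (rule sum.cong) auto
    also have "\<dots> = (if nu = nu0 then c nu else 0)"
      using finP by (simp add: permutes_id)
    finally show "(\<Sum>p\<in>?P. if nu = nu0 \<and> p = id then c nu * signof p else 0) = (if nu = nu0 then c nu else 0)" .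
  qed
  also have "\<dots> = c nu0" using fin nu0 by simp
  finally show ?thesis using Q0 by simp
qed

text \<open>Expanded in ordinary Schur functions, a partition of maximal size in the support of c
  receives a contribution from itself alone, with coefficient 1; so its coefficient in c
  vanishes.\<close>

lemma schur_lin_indep:
  assumes fin: "finite F" and part: "\<And>nu. nu \<in> F \<Longrightarrow> is_partition nu"
    and zero: "\<And>xs. (\<Sum>nu\<in>F. c nu * schur b nu xs) = 0" and nu: "nu \<in> F"
  shows "c nu = 0"
proof (rule ccontr)
  assume "c nu \<noteq> 0"
  define F' where "F' = {nu \<in> F. c nu \<noteq> 0}"
  have F': "finite F'" "F' \<noteq> {}" using fin nu \<open>c nu \<noteq> 0\<close> by (auto simp: F'_def)
  have "Max (sum_list ` F') \<in> sum_list ` F'" using F' by (intro Max_in) auto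
  then obtain nu0 where nu0: "nu0 \<in> F'" and nu0_max: "sum_list nu0 = Max (sum_list ` F')" by auto
  have max: "sum_list mu \<le> sum_list nu0" if "mu \<in> F'" for mu
    unfolding nu0_max using that F' by (intro Max_ge) auto
  define S where "S mu = {nu. is_partition nu \<and> subpart nu mu \<and> dnum nu = dnum mu}" for mu
  define k where "k mu nu = (if nu \<in> S mu then frob_coeff b (\<lambda>_. 0) mu nu else 0)" for mu nu
  define G where "G = (\<Union>mu\<in>F'. S mu)"
  have finS: "finite (S mu)" for mu
    by (rule finite_subset[OF _ finite_subparts[of mu]]) (auto simp: S_def)
  have finG: "finite G" using F' finS by (simp add: G_def)
  have part': "is_partition mu" if "mu \<in> F'" for mu using that part by (simp add: F'_def)
  have refl: "nu0 \<in> S nu0" using part'[OF nu0] by (simp add: S_def subpart_def)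
  have zero': "(\<Sum>nu\<in>G. (\<Sum>mu\<in>F'. c mu * k mu nu) * schur (\<lambda>_. 0) nu xs) = 0" for xs
  proof -
    have "(\<Sum>nu\<in>G. (\<Sum>mu\<in>F'. c mu * k mu nu) * schur (\<lambda>_. 0) nu xs)
        = (\<Sum>mu\<in>F'. c mu * (\<Sum>nu\<in>G. k mu nu * schur (\<lambda>_. 0) nu xs))"
      unfolding sum_distrib_left sum_distrib_right by (subst sum.swap) (simp add: mult.assoc)
    also have "\<dots> = (\<Sum>mu\<in>F'. c mu * schur b mu xs)"
    proof (rule sum.cong[OF HOL.refl])
      fix mu assume mu: "mu \<in> F'"
      have "(\<Sum>nu\<in>G. k mu nu * schur (\<lambda>_. 0) nu xs) = (\<Sum>nu\<in>S mu. k mu nu * schur (\<lambda>_. 0) nu xs)"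
        by (rule sum.mono_neutral_right[OF finG]) (use mu in \<open>auto simp: G_def k_def\<close>)
      also have "\<dots> = (\<Sum>nu\<in>S mu. frob_coeff b (\<lambda>_. 0) mu nu * schur (\<lambda>_. 0) nu xs)"
        by (rule sum.cong) (auto simp: k_def)
      also have "\<dots> = schur b mu xs"
        unfolding S_def by (rule schur_expansion[OF part'[OF mu], symmetric])
      finally show "c mu * (\<Sum>nu\<in>G. k mu nu * schur (\<lambda>_. 0) nu xs) = c mu * schur b mu xs" by simp
    qed
    also have "\<dots> = (\<Sum>mu\<in>F. c mu * schur b mu xs)"
      by (rule sum.mono_neutral_left) (use fin in \<open>auto simp: F'_def\<close>)
    finally show ?thesis by (simp add: zero)
  qed
  have "(\<Sum>mu\<in>F'. c mu * k mu nu0) = 0"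
    by (rule schur_zero_lin_indep[where c = "\<lambda>nu. \<Sum>mu\<in>F'. c mu * k mu nu", OF finG _ zero']) (use nu0 refl in \<open>auto simp: G_def S_def\<close>)
  moreover have "(\<Sum>mu\<in>F'. c mu * k mu nu0) = (\<Sum>mu\<in>F'. if mu = nu0 then c nu0 else 0)"
  proof (rule sum.cong[OF HOL.refl])
    fix mu assume mu: "mu \<in> F'"
    show "c mu * k mu nu0 = (if mu = nu0 then c nu0 else 0)"
    proof (cases "nu0 \<in> S mu")
      case True
      then have "subpart nu0 mu" by (simp add: S_def)
      \<comment> \<open>Containment gives size at most that of \<open>mu\<close>, maximality the
        reverse, and equal sizes force equality.\<close>
      from subpart_sum_list[OF part'[OF mu] part'[OF nu0] this] max[OF mu] have "nu0 = mu" by simp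
      then show ?thesis using refl by (simp add: k_def frob_coeff_self[OF part'[OF mu]])
    next
      case False
      then show ?thesis using refl by (auto simp: k_def)
    qed
  qed
  ultimately have "c nu0 = 0" using F' nu0 by simp
  then show False using nu0 by (simp add: F'_def)
qed

section \<open>Existence and uniqueness of the coefficients\<close>

theorem theorem7:
  fixes a b :: "int \<Rightarrow> complex" and mu :: "nat list"
  assumes "is_partition mu"
  shows "(\<exists>c. is_expansion a b mu c) \<and>
         (\<forall>c. is_expansion a b mu c \<longrightarrow>
           (\<forall>nu. is_partition nu \<longrightarrow>
              ((\<not> (subpart nu mu \<and> dnum nu = dnum mu)) \<longrightarrow> c nu = 0) \<and>
              (dnum nu = dnum mu \<longrightarrow> c nu = frob_coeff a b mu nu)))"
proof -
  define S where "S = {nu. is_partition nu \<and> subpart nu mu \<and> dnum nu = dnum mu}"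
  define k where "k nu = (if nu \<in> S then frob_coeff a b mu nu else 0)" for nu
  have finS: "finite S"
    by (rule finite_subset[OF _ finite_subparts[of mu]]) (auto simp: S_def)
  have supp: "{nu. is_partition nu \<and> k nu \<noteq> 0} \<subseteq> S" by (auto simp: k_def split: if_splits)
  \<comment> \<open>Any finite T containing the support is allowed: the support itself serves
    existence, a larger set the comparison with another expansion.\<close>
  have expand: "schur a mu xs = (\<Sum>nu\<in>T. k nu * schur b nu xs)"
    if "finite T" "{nu. is_partition nu \<and> k nu \<noteq> 0} \<subseteq> T" "\<And>nu. nu \<in> T \<Longrightarrow> is_partition nu" for T xs
  proof -
    have "schur a mu xs = (\<Sum>nu\<in>S. k nu * schur b nu xs)"
      unfolding schur_expansion[OF assms, of a xs b] by (rule sum.cong) (auto simp: S_def k_def)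
    also have "\<dots> = (\<Sum>nu | is_partition nu \<and> k nu \<noteq> 0. k nu * schur b nu xs)"
      by (rule sum.mono_neutral_right[OF finS supp]) (auto simp: S_def)
    also have "\<dots> = (\<Sum>nu\<in>T. k nu * schur b nu xs)"
      by (rule sum.mono_neutral_left[OF that(1,2)]) (use that(3) in auto)
    finally show ?thesis .
  qed
  have "is_expansion a b mu k"
    unfolding is_expansion_def using finite_subset[OF supp finS] expand by auto
  then have ex: "\<exists>c. is_expansion a b mu c" by blast
  have eq: "c nu = k nu" if c: "is_expansion a b mu c" and nu: "is_partition nu" for c nu
  proof -
    \<comment> \<open>Contains both supports, and also \<open>nu\<close>, so that the comparison
      covers a \<open>nu\<close> outside them.\<close>
    define T where "T = insert nu (S \<union> {nu. is_partition nu \<and> c nu \<noteq> 0})"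
    have finT: "finite T" using c finS by (simp add: T_def is_expansion_def)
    have partT: "is_partition nu" if "nu \<in> T" for nu using that nu by (auto simp: T_def S_def)
    have "(\<Sum>nu\<in>T. (c nu - k nu) * schur b nu xs) = 0" for xs
    proof -
      have "schur a mu xs = (\<Sum>nu | is_partition nu \<and> c nu \<noteq> 0. c nu * schur b nu xs)"
        using c by (simp add: is_expansion_def)
      also have "\<dots> = (\<Sum>nu\<in>T. c nu * schur b nu xs)"
        by (rule sum.mono_neutral_left[OF finT]) (use partT in \<open>auto simp: T_def\<close>)
      finally have "schur a mu xs = (\<Sum>nu\<in>T. c nu * schur b nu xs)" .
      moreover have "schur a mu xs = (\<Sum>nu\<in>T. k nu * schur b nu xs)"
        by (rule expand[OF finT _ partT]) (use supp in \<open>auto simp: T_def\<close>)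
      ultimately show ?thesis by (simp add: algebra_simps sum_subtractf)
    qed
    from schur_lin_indep[OF finT partT this, of nu] show ?thesis by (simp add: T_def)
  qed
  \<comment> \<open>Where \<nu> is not contained in \<mu>, the product of determinants is itself
    zero and agrees with the default value of k.\<close>
  have k: "k nu = frob_coeff a b mu nu" if "is_partition nu" "dnum nu = dnum mu" for nu
    using frob_coeff_nonzero_imp_subpart[OF assms that, of a b] that by (auto simp: k_def S_def)
  have "k nu = 0" if "\<not> (subpart nu mu \<and> dnum nu = dnum mu)" for nu
    using that by (auto simp: k_def S_def)
  with ex eq k show ?thesis by metis
qed

end
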